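(* Let $0<q<1$, let $\mathfrak u_+$ be the adjoint module of $U_q(\mathfrak{sl}(2))$ with basis $\{v_1,v_0,v_{-1}\}$ and dual basis $\{w_1,w_0,w_{-1}\}$ of $\mathfrak u_-$, and let $\Gamma_i=\gamma_-(w_i)\in\mathrm{End}(\Lambda_q(\mathfrak u_+))$ for $i\in\{1,0,-1\}$. Then there do not exist complex coefficients $c_{ij}^{kl}$ ($i,j,k,l\in\{1,0,-1\}$, $i\neq j$) such that $$\Gamma_i\Gamma_j^*=\sum_{k,l}c_{ij}^{kl}\,\Gamma_k^*\Gamma_l\qquad\text{for all } i\ne j .$$ This holds for any choice of the rescaling factors, in each degree, of the pairing and of the inner product used to define $\gamma_-$ and the adjoint.
   Context: $U_q(\mathfrak{sl}(2))$ has generators $K^{\pm1},E,F$ with $KEK^{-1}=q^2E$, $KFK^{-1}=q^{-2}F$, $EF-FE=\frac{K-K^{-1}}{q-q^{-1}}$; $\Delta(K)=K\otimes K$, $\Delta(E)=E\otimes1+K\otimes E$, $\Delta(F)=F\otimes K^{-1}+1\otimes F$; $S(K)=K^{-1}$, $S(E)=-K^{-1}E$, $S(F)=-FK$; $K^*=K$, $E^*=KF$, $F^*=EK^{-1}$. $[2]=q+q^{-1}$. The module $\mathfrak u_+$: $Kv_{1}=q^2v_1$, $Kv_0=v_0$, $Kv_{-1}=q^{-2}v_{-1}$; $Ev_1=0$, $Ev_0=[2]^{1/2}v_1$, $Ev_{-1}=[2]^{1/2}v_0$; $Fv_1=[2]^{1/2}v_0$, $Fv_0=[2]^{1/2}v_{-1}$,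 $Fv_{-1}=0$. (It is the nilradical for the Lagrangian Grassmannian $LG(2,4)$: $\mathfrak g=\mathfrak{sp}(4)$, long simple root $\alpha_2$ removed. The quantized Levi factor $U_q(\mathfrak l)$ is generated by $K_1=K$, $E_1=E$, $F_1=F$ and $K_2^{\pm1}$, with $K_2v_1=v_1$, $K_2v_0=q^2v_0$, $K_2v_{-1}=q^4v_{-1}$, $K_2$ group-like, $K_2^*=K_2$.) $\mathfrak u_-$ is the dual space, $\langle w_i,v_j\rangle=\delta_{ij}$, with the action making the pairing invariant: $\langle X_{(1)}w,X_{(2)}v\rangle=\varepsilon(X)\langle w,v\rangle$. Exterior algebras: for finite-dimensional weight modules $V,W$, the braiding $\hat R_{V,W}:V\otimes W\to W\otimes V$ is the module map determined by $\hat R_{V,W}(v\otimes w)=q^{(\mathrm{wt}(v),\mathrm{wt}(w))}w\otimes v+\sum_iw_i\otimes v_i$ with $\mathrm{wt}(w_i)>\mathrm{wt}(w)$ and $\mathrm{wt}(v_i)<\mathrm{wt}(v)$ (here $(\alpha,\alpha)=2$ for the simple root $\alpha$ of $\mathfrak{sl}(2)$). For $V=\mathfrak u_\pm$, $S_q^2V$ (resp. $\Lambda_q^2V$) is the span of eigenvectors of $\hat R_{V,V}$ with positive (resp. negative) eigenvalues and $\Lambda_q(V)=T(V)/\langle S_q^2V\rangle$, graded, with product $\wedge$. Let $\Lambda_q^kV\subset V^{\otimes k}$ be the tensors lying in $V^{\otimes i}\otimes\Lambda_q^2V\otimes V^{\otimes(k-2-i)}$ for all $i$; the composite $\pi:\Lambda_q^kV\hookrightarrow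 V^{\otimes k}\twoheadrightarrow\Lambda_q^k(V)$ is an isomorphism ($\pi_\pm$ for $V=\mathfrak u_\pm$). With $\langle x_k\otimes\cdots\otimes x_1,y_1\otimes\cdots\otimes y_k\rangle_T=\prod_i\langle x_i,y_i\rangle$, set $\langle w,v\rangle_k=\lambda_k\langle\pi_-^{-1}(w),\pi_+^{-1}(v)\rangle_T$ on $\Lambda_q^k(\mathfrak u_-)\otimes\Lambda_q^k(\mathfrak u_+)$, with arbitrary nonzero scalars $\lambda_k$. For $z\in\mathfrak u_-$, $\gamma_-(z)$ is the degree $-1$ operator on $\Lambda_q(\mathfrak u_+)$ with $\langle w,\gamma_-(z)v\rangle_k=\langle w\wedge z,v\rangle_{k+1}$ for $w\in\Lambda_q^k(\mathfrak u_-)$, $v\in\Lambda_q^{k+1}(\mathfrak u_+)$, and $\gamma_-(z)1=0$. The adjoint $*$ is taken with respect to a Hermitian inner product on $\Lambda_q(\mathfrak u_+)$ (conjugate-linear in the first variable, different degrees orthogonal) satisfying $(v,Xv')=(X^*v,v')$ for all $X\in U_q(\mathfrak l)$; it is unique up to a positive rescaling in each degree. *)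

theory Defs
  imports Complex_Main "HOL-Library.Poly_Mapping" "HOL-Algebra.QuotRing"
begin

text \<open>Lists form the free monoid, so \<^typ>\<open>'a list \<Rightarrow>\<^sub>0 complex\<close> with its library
  multiplication is the free associative algebra, i.e. the tensor algebra of the vector space with
  basis \<^typ>\<open>'a\<close>. A word \<open>[i, j, \<dots>]\<close> stands for the basis tensor \<open>v\<^sub>i \<otimes> v\<^sub>j \<otimes> \<dots>\<close>,
  and \<open>Poly_Mapping.single [] c\<close> for the scalar \<open>c\<close>.\<close>

instantiation list :: (type) monoid_add
begin
definition zero_list :: "'a list" where "0 = []"
definition plus_list :: "'a list \<Rightarrow> 'a list \<Rightarrow> 'a list" where "xs + ys = xs @ ys"
instance by standard (simp_all add: zero_list_def plus_list_def)
end

type_synonym 'a falg = "'a list \<Rightarrow>\<^sub>0 complex"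

definition wmon :: "'a list \<Rightarrow> 'a falg" where
  "wmon w = Poly_Mapping.single w 1"

definition smul :: "complex \<Rightarrow> 'a falg \<Rightarrow> 'a falg" where
  "smul c x = Poly_Mapping.single [] c * x"

global_interpretation falg: vector_space "smul :: complex \<Rightarrow> 'a falg \<Rightarrow> 'a falg"
proof
  fix a b :: complex and x y :: "'a falg"
  show "smul a (x + y) = smul a x + smul a y" by (simp add: smul_def algebra_simps)
  show "smul (a + b) x = smul a x + smul b x" by (simp add: smul_def single_add algebra_simps)
  show "smul a (smul b x) = smul (a * b) x"
    by (simp add: smul_def mult.assoc [symmetric] mult_single plus_list_def)
  show "smul 1 x = x"
    using single_one [where ?'a = "'a list" and ?'b = complex]
    by (simp add: smul_def zero_list_def)
qed

lemma lookup_smul: "Poly_Mapping.lookup (smul c x) w = c * Poly_Mapping.lookup x w"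
proof -
  have "Poly_Mapping.lookup (Poly_Mapping.single 0 c * x) w = c * Poly_Mapping.lookup x w"
    by (simp add: mult_map_scale_conv_mult [symmetric] Poly_Mapping.map.rep_eq when_def)
  then show ?thesis by (simp add: smul_def zero_list_def)
qed

definition linext :: "('a list \<Rightarrow> 'b falg) \<Rightarrow> 'a falg \<Rightarrow> 'b falg" where
  "linext f x = (\<Sum>w\<in>Poly_Mapping.keys x. smul (Poly_Mapping.lookup x w) (f w))"

definition tens :: "nat \<Rightarrow> 'a falg set" where
  "tens k = {t. \<forall>w\<in>Poly_Mapping.keys t. length w = k}"

text \<open>Elements of \<open>U\<^sub>q(\<ll>)\<close> are represented by elements of the free algebra on its generators.
  All notions below depend only on the action on modules, where the defining relations hold.\<close>

datatype uq_gen = K1 | K1inv | E1 | F1 | K2 | K2inv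

definition uq_sl2 :: "uq_gen falg set" where
  "uq_sl2 = {X. \<forall>u\<in>Poly_Mapping.keys X. set u \<subseteq> {K1, K1inv, E1, F1}}"

fun antipode_gen :: "uq_gen \<Rightarrow> uq_gen falg" where
  "antipode_gen K1 = wmon [K1inv]"
| "antipode_gen K1inv = wmon [K1]"
| "antipode_gen E1 = - wmon [K1inv, E1]"
| "antipode_gen F1 = - wmon [F1, K1]"
| "antipode_gen K2 = wmon [K2inv]"
| "antipode_gen K2inv = wmon [K2]"

fun star_gen :: "uq_gen \<Rightarrow> uq_gen falg" where
  "star_gen E1 = wmon [K1, F1]"
| "star_gen F1 = wmon [E1, K1inv]"
| "star_gen g = wmon [g]"

definition uq_star :: "uq_gen falg \<Rightarrow> uq_gen falg" where
  "uq_star X = (\<Sum>u\<in>Poly_Mapping.keys X.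
     smul (cnj (Poly_Mapping.lookup X u)) (prod_list (map star_gen (rev u))))"

datatype idx = I1 | I0 | Im1

lemma UNIV_idx: "UNIV = {I1, I0, Im1}"
  using idx.exhaust by auto

instance idx :: finite
  by standard (simp add: UNIV_idx)

text \<open>A module with a basis of weight vectors indexed by \<^typ>\<open>idx\<close>: \<open>weight M i = n\<close> says that
  the \<open>i\<close>-th basis vector has weight \<open>n \<alpha>\<close>, and \<open>mat M g j i\<close> is the coefficient of the
  \<open>j\<close>-th basis vector in \<open>g\<close> applied to the \<open>i\<close>-th one.\<close>

record uq_module =
  weight :: "idx \<Rightarrow> int"
  mat :: "uq_gen \<Rightarrow> idx \<Rightarrow> idx \<Rightarrow> complex"

definition vec :: "uq_module \<Rightarrow> uq_gen \<Rightarrow> idx \<Rightarrow> idx falg" where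
  "vec M g i = (\<Sum>j\<in>UNIV. Poly_Mapping.single [j] (mat M g j i))"

text \<open>Generators act on tensor powers through the counit and the coproduct
  \<open>\<Delta>(E) = E \<otimes> 1 + K \<otimes> E\<close>, \<open>\<Delta>(F) = F \<otimes> K\<^sup>-\<^sup>1 + 1 \<otimes> F\<close>, the other generators being group-like.\<close>

fun gen_on_word :: "uq_module \<Rightarrow> uq_gen \<Rightarrow> idx list \<Rightarrow> idx falg" where
  "gen_on_word M g [] = (if g = E1 \<or> g = F1 then 0 else 1)"
| "gen_on_word M g (i # w) =
     (if g = E1 then vec M E1 i * wmon w + vec M K1 i * gen_on_word M E1 w
      else if g = F1 then vec M F1 i * gen_on_word M K1inv w + wmon [i] * gen_on_word M F1 w
      else vec M g i * gen_on_word M g w)"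

definition uq_act :: "uq_module \<Rightarrow> uq_gen falg \<Rightarrow> idx falg \<Rightarrow> idx falg" where
  "uq_act M X t = (\<Sum>u\<in>Poly_Mapping.keys X.
     smul (Poly_Mapping.lookup X u) (foldr (\<lambda>g. linext (gen_on_word M g)) u t))"

fun idx_wt :: "idx \<Rightarrow> int" where
  "idx_wt I1 = 1"
| "idx_wt I0 = 0"
| "idx_wt Im1 = -1"

fun u_plus_mat :: "real \<Rightarrow> uq_gen \<Rightarrow> idx \<Rightarrow> idx \<Rightarrow> complex" where
  "u_plus_mat q K1 j i = (if j = i then of_real (q powi (2 * idx_wt i)) else 0)"
| "u_plus_mat q K1inv j i = (if j = i then of_real (q powi (- 2 * idx_wt i)) else 0)"
| "u_plus_mat q E1 j i = (if idx_wt j = idx_wt i + 1 then of_real (sqrt (q + inverse q)) else 0)"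
| "u_plus_mat q F1 j i = (if idx_wt j = idx_wt i - 1 then of_real (sqrt (q + inverse q)) else 0)"
| "u_plus_mat q K2 j i = (if j = i then of_real (q powi (2 - 2 * idx_wt i)) else 0)"
| "u_plus_mat q K2inv j i = (if j = i then of_real (q powi (2 * idx_wt i - 2)) else 0)"

definition u_plus :: "real \<Rightarrow> uq_module" where
  "u_plus q = \<lparr>weight = idx_wt, mat = u_plus_mat q\<rparr>"

text \<open>The dual module, on the dual basis: \<open>\<langle>X w, v\<rangle> = \<langle>w, S(X) v\<rangle>\<close>. See the lemma
  \<open>pairing_invariant\<close> below for the invariance of the pairing that characterizes it.\<close>

definition dual_module :: "uq_module \<Rightarrow> uq_module" where
  "dual_module M = \<lparr>weight = (\<lambda>i. - weight M i),
     mat = (\<lambda>g j i. Poly_Mapping.lookup (uq_act M (antipode_gen g) (wmon [j])) [i])\<rparr>"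

definition u_minus :: "real \<Rightarrow> uq_module" where
  "u_minus q = dual_module (u_plus q)"

definition linear_on :: "'a falg set \<Rightarrow> ('a falg \<Rightarrow> 'b falg) \<Rightarrow> bool" where
  "linear_on V f \<longleftrightarrow> (\<forall>x\<in>V. \<forall>y\<in>V. f (x + y) = f x + f y) \<and> (\<forall>c. \<forall>x\<in>V. f (smul c x) = smul c (f x))"

text \<open>Since \<open>(\<alpha>, \<alpha>) = 2\<close>, the pairing of the weights \<open>m \<alpha>\<close> and \<open>n \<alpha>\<close> is \<open>2 m n\<close>.\<close>

definition braiding :: "real \<Rightarrow> uq_module \<Rightarrow> idx falg \<Rightarrow> idx falg" where
  "braiding q M = (THE R. R \<in> extensional (tens 2) \<and> R \<in> tens 2 \<rightarrow> tens 2 \<and> linear_on (tens 2) R \<and>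
     (\<forall>X\<in>uq_sl2. \<forall>t\<in>tens 2. R (uq_act M X t) = uq_act M X (R t)) \<and>
     (\<forall>i j. R (wmon [i, j]) - smul (of_real (q powi (2 * weight M i * weight M j))) (wmon [j, i])
        \<in> falg.span {wmon [a, b] | a b. weight M a > weight M j \<and> weight M b < weight M i}))"

definition sym2 :: "real \<Rightarrow> uq_module \<Rightarrow> idx falg set" where
  "sym2 q M = falg.span {t \<in> tens 2. t \<noteq> 0 \<and> (\<exists>\<mu>::real. \<mu> > 0 \<and> braiding q M t = smul (of_real \<mu>) t)}"

definition alt2 :: "real \<Rightarrow> uq_module \<Rightarrow> idx falg set" where
  "alt2 q M = falg.span {t \<in> tens 2. t \<noteq> 0 \<and> (\<exists>\<mu>::real. \<mu> < 0 \<and> braiding q M t = smul (of_real \<mu>) t)}"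

definition tensor_ring :: "idx falg ring" where
  "tensor_ring = \<lparr>carrier = UNIV, monoid.mult = (*), one = 1, ring.zero = 0, add = (+)\<rparr>"

lemma ring_tensor_ring: "ring tensor_ring"
proof (rule ringI)
  show "abelian_group tensor_ring"
  proof (rule abelian_groupI)
    fix x assume "x \<in> carrier tensor_ring"
    show "\<exists>y\<in>carrier tensor_ring. y \<oplus>\<^bsub>tensor_ring\<^esub> x = \<zero>\<^bsub>tensor_ring\<^esub>"
      by (rule bexI [of _ "- x"]) (simp_all add: tensor_ring_def)
  qed (simp_all add: tensor_ring_def algebra_simps)
  show "Group.monoid tensor_ring"
    by (rule monoidI) (simp_all add: tensor_ring_def mult.assoc)
qed (simp_all add: tensor_ring_def algebra_simps)

definition ext_ideal :: "real \<Rightarrow> uq_module \<Rightarrow> idx falg set" where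
  "ext_ideal q M = genideal tensor_ring (sym2 q M)"

definition ext_alg :: "real \<Rightarrow> uq_module \<Rightarrow> idx falg set ring" where
  "ext_alg q M = tensor_ring Quot ext_ideal q M"

definition ext_cls :: "real \<Rightarrow> uq_module \<Rightarrow> idx falg \<Rightarrow> idx falg set" where
  "ext_cls q M t = ext_ideal q M +>\<^bsub>tensor_ring\<^esub> t"

lemma ideal_ext_ideal: "ideal (ext_ideal q M) tensor_ring"
  unfolding ext_ideal_def
  by (rule ring.genideal_ideal [OF ring_tensor_ring]) (simp add: tensor_ring_def)

lemma ring_ext_alg: "ring (ext_alg q M)"
  unfolding ext_alg_def by (rule ideal.quotient_is_ring [OF ideal_ext_ideal])

definition ext_scale :: "real \<Rightarrow> uq_module \<Rightarrow> complex \<Rightarrow> idx falg set \<Rightarrow> idx falg set" where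
  "ext_scale q M c A = ext_cls q M (Poly_Mapping.single [] c) \<otimes>\<^bsub>ext_alg q M\<^esub> A"

lemma ext_scale_cls: "ext_scale q M c (ext_cls q M t) = ext_cls q M (smul c t)"
  using ideal.rcoset_mult_add [OF ideal_ext_ideal, of "Poly_Mapping.single [] c" t q M]
  by (simp add: ext_scale_def ext_alg_def FactRing_def ext_cls_def smul_def tensor_ring_def)

definition ext_deg :: "real \<Rightarrow> uq_module \<Rightarrow> nat \<Rightarrow> idx falg set set" where
  "ext_deg q M k = ext_cls q M ` tens k"

text \<open>The subspace \<open>\<Lambda>\<^sub>q\<^sup>k V\<close> of the \<open>k\<close>-th tensor power, and the inverse of its projection
  to degree \<open>k\<close> of the exterior algebra.\<close>

definition ext_tensors :: "real \<Rightarrow> uq_module \<Rightarrow> nat \<Rightarrow> idx falg set" where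
  "ext_tensors q M k = {t \<in> tens k. \<forall>i. i + 2 \<le> k \<longrightarrow>
     t \<in> falg.span {a * x * b | a x b. a \<in> tens i \<and> x \<in> alt2 q M \<and> b \<in> tens (k - 2 - i)}}"

definition pi_inv :: "real \<Rightarrow> uq_module \<Rightarrow> nat \<Rightarrow> idx falg set \<Rightarrow> idx falg" where
  "pi_inv q M k = the_inv_into (ext_tensors q M k) (ext_cls q M)"

text \<open>Words are reversed because \<open>x\<^sub>k \<otimes> \<dots> \<otimes> x\<^sub>1\<close> is paired with
  \<open>y\<^sub>1 \<otimes> \<dots> \<otimes> y\<^sub>k\<close> to \<open>\<langle>x\<^sub>1, y\<^sub>1\<rangle> \<dots> \<langle>x\<^sub>k, y\<^sub>k\<rangle>\<close>. The first argument is a tensor in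
  the dual basis.\<close>

definition tensor_pair :: "idx falg \<Rightarrow> idx falg \<Rightarrow> complex" where
  "tensor_pair s t =
     (\<Sum>w\<in>Poly_Mapping.keys t. Poly_Mapping.lookup s (rev w) * Poly_Mapping.lookup t w)"

definition ext_pair ::
    "real \<Rightarrow> (nat \<Rightarrow> complex) \<Rightarrow> nat \<Rightarrow> idx falg set \<Rightarrow> idx falg set \<Rightarrow> complex" where
  "ext_pair q lam k w v = lam k * tensor_pair (pi_inv q (u_minus q) k w) (pi_inv q (u_plus q) k v)"

definition ext_End :: "real \<Rightarrow> uq_module \<Rightarrow> (idx falg set \<Rightarrow> idx falg set) set" where
  "ext_End q M = {G. G \<in> extensional (carrier (ext_alg q M)) \<and>
     G \<in> carrier (ext_alg q M) \<rightarrow> carrier (ext_alg q M) \<and>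
     (\<forall>x\<in>carrier (ext_alg q M). \<forall>y\<in>carrier (ext_alg q M).
        G (x \<oplus>\<^bsub>ext_alg q M\<^esub> y) = G x \<oplus>\<^bsub>ext_alg q M\<^esub> G y) \<and>
     (\<forall>c. \<forall>x\<in>carrier (ext_alg q M). G (ext_scale q M c x) = ext_scale q M c (G x))}"

definition gamma_minus ::
    "real \<Rightarrow> (nat \<Rightarrow> complex) \<Rightarrow> idx falg \<Rightarrow> idx falg set \<Rightarrow> idx falg set" where
  "gamma_minus q lam z = (THE G. G \<in> ext_End q (u_plus q) \<and>
     G \<one>\<^bsub>ext_alg q (u_plus q)\<^esub> = \<zero>\<^bsub>ext_alg q (u_plus q)\<^esub> \<and>
     (\<forall>k. \<forall>v\<in>ext_deg q (u_plus q) (Suc k). G v \<in> ext_deg q (u_plus q) k \<and>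
        (\<forall>w\<in>ext_deg q (u_minus q) k. ext_pair q lam k w (G v) =
           ext_pair q lam (Suc k) (w \<otimes>\<^bsub>ext_alg q (u_minus q)\<^esub> ext_cls q (u_minus q) z) v)))"

definition Gam ::
    "real \<Rightarrow> (nat \<Rightarrow> complex) \<Rightarrow> idx \<Rightarrow> idx falg set \<Rightarrow> idx falg set" where
  "Gam q lam i = gamma_minus q lam (wmon [i])"

definition invariant_inner_product ::
    "real \<Rightarrow> (idx falg set \<Rightarrow> idx falg set \<Rightarrow> complex) \<Rightarrow> bool" where
  "invariant_inner_product q ip \<longleftrightarrow> (let A = ext_alg q (u_plus q) in
     (\<forall>u\<in>carrier A. \<forall>v\<in>carrier A. \<forall>w\<in>carrier A. ip u (v \<oplus>\<^bsub>A\<^esub> w) = ip u v + ip u w) \<and>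
     (\<forall>c. \<forall>u\<in>carrier A. \<forall>v\<in>carrier A. ip u (ext_scale q (u_plus q) c v) = c * ip u v) \<and>
     (\<forall>u\<in>carrier A. \<forall>v\<in>carrier A. ip v u = cnj (ip u v)) \<and>
     (\<forall>v\<in>carrier A. v \<noteq> \<zero>\<^bsub>A\<^esub> \<longrightarrow> Re (ip v v) > 0) \<and>
     (\<forall>k l. k \<noteq> l \<longrightarrow> (\<forall>u\<in>ext_deg q (u_plus q) k. \<forall>v\<in>ext_deg q (u_plus q) l. ip u v = 0)) \<and>
     (\<forall>X s t. ip (ext_cls q (u_plus q) s) (ext_cls q (u_plus q) (uq_act (u_plus q) X t)) =
        ip (ext_cls q (u_plus q) (uq_act (u_plus q) (uq_star X) s)) (ext_cls q (u_plus q) t)))"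

definition ext_adj :: "real \<Rightarrow> (idx falg set \<Rightarrow> idx falg set \<Rightarrow> complex) \<Rightarrow>
    (idx falg set \<Rightarrow> idx falg set) \<Rightarrow> idx falg set \<Rightarrow> idx falg set" where
  "ext_adj q ip G = (THE H. H \<in> ext_End q (u_plus q) \<and>
     (\<forall>u\<in>carrier (ext_alg q (u_plus q)). \<forall>v\<in>carrier (ext_alg q (u_plus q)).
        ip u (G v) = ip (H u) v))"

lemma wmon_Nil: "wmon [] = 1"
  using single_one [where ?'a = "'a list" and ?'b = complex] by (simp add: wmon_def zero_list_def)

lemma gen_on_basis: "gen_on_word M g [i] = vec M g i"
  by (cases g) (simp_all add: wmon_Nil)

lemma linext_superset:
  assumes "finite S" "Poly_Mapping.keys x \<subseteq> S"
  shows "linext f x = (\<Sum>w\<in>S. smul (Poly_Mapping.lookup x w) (f w))"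
  unfolding linext_def
  by (rule sum.mono_neutral_left) (use assms in \<open>auto simp: in_keys_iff\<close>)

lemma linext_add: "linext f (x + y) = linext f x + linext f y"
proof -
  let ?S = "Poly_Mapping.keys x \<union> Poly_Mapping.keys y"
  have "linext f (x + y) = (\<Sum>w\<in>?S. smul (Poly_Mapping.lookup (x + y) w) (f w))"
    by (rule linext_superset) (simp_all add: keys_add)
  also have "\<dots> = (\<Sum>w\<in>?S. smul (Poly_Mapping.lookup x w) (f w)) +
      (\<Sum>w\<in>?S. smul (Poly_Mapping.lookup y w) (f w))"
    by (simp add: lookup_add falg.scale_left_distrib sum.distrib)
  also have "\<dots> = linext f x + linext f y"
    by (simp add: linext_superset [of ?S x] linext_superset [of ?S y])
  finally show ?thesis .
qed

lemma linext_sum: "linext f (\<Sum>a\<in>A. x a) = (\<Sum>a\<in>A. linext f (x a))"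
proof (induction A rule: infinite_finite_induct)
  case (insert a A)
  then show ?case by (simp add: linext_add)
qed (simp_all add: linext_def)

lemma linext_single: "linext f (Poly_Mapping.single w c) = smul c (f w)"
  by (subst linext_superset [of "{w}"]) (auto simp: lookup_single)

lemma uq_act_mon: "uq_act M (wmon u) t = foldr (\<lambda>g. linext (gen_on_word M g)) u t"
  by (simp add: uq_act_def wmon_def)

lemma uq_act_uminus: "uq_act M (- X) t = - uq_act M X t"
proof -
  have "Poly_Mapping.keys (- X) = Poly_Mapping.keys X"
    by (auto simp: in_keys_iff)
  then show ?thesis
    by (simp add: uq_act_def sum_negf)
qed

lemma linext_vec: "linext (gen_on_word M g) (vec M h i) = (\<Sum>k\<in>UNIV. smul (mat M h k i) (vec M g k))"
  unfolding vec_def [of M h i] by (simp add: linext_sum linext_single gen_on_basis del: gen_on_word.simps)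

lemma linext_mon: "linext (gen_on_word M g) (wmon [i]) = vec M g i"
  by (simp add: wmon_def linext_single gen_on_basis del: gen_on_word.simps)

lemma lookup_vec: "Poly_Mapping.lookup (vec M g i) [j] = mat M g j i"
  by (cases j) (simp_all add: vec_def lookup_sum UNIV_idx lookup_add lookup_single when_def)

lemma mat_dual_module:
  "mat (dual_module M) K1 j i = mat M K1inv i j"
  "mat (dual_module M) K1inv j i = mat M K1 i j"
  "mat (dual_module M) E1 j i = - (\<Sum>k\<in>UNIV. mat M E1 k j * mat M K1inv i k)"
  "mat (dual_module M) F1 j i = - (\<Sum>k\<in>UNIV. mat M K1 k j * mat M F1 i k)"
  "mat (dual_module M) K2 j i = mat M K2inv i j"
  "mat (dual_module M) K2inv j i = mat M K2 i j"
  by (simp_all add: dual_module_def uq_act_mon uq_act_uminus linext_mon linext_vec lookup_vec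
      lookup_sum lookup_smul)

lemma tensor_pair_superset:
  assumes "finite S" "Poly_Mapping.keys t \<subseteq> S"
  shows "tensor_pair s t = (\<Sum>w\<in>S. Poly_Mapping.lookup s (rev w) * Poly_Mapping.lookup t w)"
  unfolding tensor_pair_def
  by (rule sum.mono_neutral_left) (use assms in \<open>auto simp: in_keys_iff\<close>)

lemma tensor_pair_vec:
  "tensor_pair s (vec M g i) = (\<Sum>k\<in>UNIV. Poly_Mapping.lookup s [k] * mat M g k i)"
proof -
  have "Poly_Mapping.keys (vec M g i) \<subseteq> (\<lambda>k. [k]) ` UNIV"
    unfolding vec_def by (rule order.trans [OF keys_sum]) (auto split: if_splits)
  then have "tensor_pair s (vec M g i) =
      (\<Sum>w\<in>(\<lambda>k. [k]) ` UNIV. Poly_Mapping.lookup s (rev w) * Poly_Mapping.lookup (vec M g i) w)"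
    by (intro tensor_pair_superset) auto
  then show ?thesis
    by (simp add: sum.reindex inj_on_def lookup_vec)
qed

lemma lookup_wmon: "Poly_Mapping.lookup (wmon w) v = (if v = w then 1 else 0)"
  by (simp add: wmon_def lookup_single when_def)

lemma tensor_pair_mon: "tensor_pair s (wmon [i]) = Poly_Mapping.lookup s [i]"
  by (simp add: tensor_pair_def wmon_def)

lemma pairing_invariant:
  assumes "q > 0"
  shows "g \<in> {K1, K1inv, K2, K2inv} \<Longrightarrow>
      tensor_pair (vec (u_minus q) g i) (vec (u_plus q) g j) = tensor_pair (wmon [i]) (wmon [j])"
    and "tensor_pair (vec (u_minus q) E1 i) (wmon [j]) +
      tensor_pair (vec (u_minus q) K1 i) (vec (u_plus q) E1 j) = 0"
    and "tensor_pair (vec (u_minus q) F1 i) (vec (u_plus q) K1inv j) +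
      tensor_pair (wmon [i]) (vec (u_plus q) F1 j) = 0"
proof -
  note defs = tensor_pair_vec tensor_pair_mon lookup_vec u_minus_def mat_dual_module UNIV_idx
    lookup_wmon u_plus_def power_int_minus
  show "tensor_pair (vec (u_minus q) g i) (vec (u_plus q) g j) = tensor_pair (wmon [i]) (wmon [j])"
    if "g \<in> {K1, K1inv, K2, K2inv}"
    using that assms by (cases i; cases j; auto simp: defs)
  show "tensor_pair (vec (u_minus q) E1 i) (wmon [j]) +
      tensor_pair (vec (u_minus q) K1 i) (vec (u_plus q) E1 j) = 0"
    by (cases i; cases j; simp add: defs)
  show "tensor_pair (vec (u_minus q) F1 i) (vec (u_plus q) K1inv j) +
      tensor_pair (wmon [i]) (vec (u_plus q) F1 j) = 0"
    using assms by (cases i; cases j; simp add: defs)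
qed

end

theory Submission
  imports Defs
begin

text \<open>Write \<open>p = q\<^sup>2\<close>. The exterior algebra of the adjoint module has dimensions 1, 3, 3, 1. Its
  relations reduce every word to a multiple of one of the normal words \<open>1\<close>, \<open>v\<^sub>1\<close>, \<open>v\<^sub>0\<close>, \<open>v\<^sub>-\<^sub>1\<close>,
  \<open>v\<^sub>1 v\<^sub>0\<close>, \<open>v\<^sub>1 v\<^sub>-\<^sub>1\<close>, \<open>v\<^sub>0 v\<^sub>-\<^sub>1\<close>, \<open>v\<^sub>1 v\<^sub>0 v\<^sub>-\<^sub>1\<close> (\<open>word_reduction\<close>, \<open>ext_ideal_eq\<close>), and dually the
  antisymmetric tensors have one basis element for each normal word (\<open>ext_tensors_expand\<close>). In
  degree 2 these are \<open>x\<^sub>1 = v\<^sub>1 v\<^sub>0 - p v\<^sub>0 v\<^sub>1\<close>, \<open>x\<^sub>0 = v\<^sub>1 v\<^sub>-\<^sub>1 + (1 - p) v\<^sub>0 v\<^sub>0 - v\<^sub>-\<^sub>1 v\<^sub>1\<close> and \<open>x\<^sub>-\<^sub>1 = v\<^sub>0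
  v\<^sub>-\<^sub>1 - p v\<^sub>-\<^sub>1 v\<^sub>0\<close>.

  On antisymmetric tensors \<open>\<Gamma>\<^sub>i\<close> is, up to a scalar \<open>\<mu>\<^sub>k\<close> in each degree, the contraction of the
  first factor with \<open>w\<^sub>i\<close> (\<open>Gam_eq\<close>, \<open>gam_alt\<close>), and invariance makes the basis orthogonal with
  \<open>v\<^sub>1\<close> and \<open>v\<^sub>0\<close> of squared norm \<open>N\<^sub>1\<close>, \<open>v\<^sub>-\<^sub>1\<close> of squared norm \<open>p N\<^sub>1\<close>, and \<open>x\<^sub>1\<close> and \<open>x\<^sub>0\<close> of the same
  squared norm \<open>N\<^sub>2\<close> (\<open>sqn_relations\<close>).

  Suppose that \<open>\<Gamma>\<^sub>1 \<Gamma>\<^sub>0\<^sup>* = \<Sum> c\<^sub>k\<^sub>l \<Gamma>\<^sub>k\<^sup>* \<Gamma>\<^sub>l\<close>, and set \<open>A = |\<mu>\<^sub>1|\<^sup>2 N\<^sub>1\<^sup>2 / N\<^sub>2\<close> and \<open>C = |\<mu>\<^sub>0|\<^sup>2 N\<^sub>0\<close>. The matrix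
  entries in degree 1 at \<open>(v\<^sub>0, v\<^sub>1)\<close> and \<open>(v\<^sub>-\<^sub>1, v\<^sub>0)\<close> give \<open>c\<^sub>0\<^sub>1 C = - p A\<close> and \<open>c\<^sub>-\<^sub>1\<^sub>0 C = p (1 - p)
  A\<close>. In degree 2 the left side vanishes on \<open>x\<^sub>1\<close>, as \<open>\<Gamma>\<^sub>0\<^sup>*\<close> preserves weights and degree 3 has
  weight 0; its entry at \<open>(x\<^sub>0, x\<^sub>1)\<close> gives \<open>(1 - p) c\<^sub>0\<^sub>1 + p c\<^sub>-\<^sub>1\<^sub>0 = 0\<close>. Together \<open>p (1 - p)\<^sup>2 A =
  0\<close>, which is impossible for \<open>0 < q < 1\<close>. The scale factors enter only through the nonzero
  numbers \<open>A\<close> and \<open>C\<close>.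

  The definitions by unique description require the braiding to be computed first (\<open>braiding_eq\<close>).
  Both the module and its dual are the adjoint module in a rescaled basis, and the braiding is
  determined by the weight condition on five basis vectors together with the action of \<open>F\<close>. The
  map from antisymmetric tensors to the exterior algebra is bijective because the matrix that
  pairs the antisymmetric tensors with the functionals vanishing on the relations is diagonal and
  has nonzero entries (\<open>alt_norm_nonzero\<close>).\<close>

section \<open>The free algebra\<close>

lemma smul_wmon: "smul c (wmon w) = Poly_Mapping.single w c"
  by (simp add: smul_def wmon_def mult_single plus_list_def)

lemma wmon_mult: "wmon u * wmon v = wmon (u @ v)"
  by (simp add: wmon_def mult_single plus_list_def)

lemma smul_mult_left: "smul c x * y = smul c (x * y)"
  by (simp add: smul_def mult.assoc)

lemma falg_expand: "t = (\<Sum>w\<in>Poly_Mapping.keys t. smul (Poly_Mapping.lookup t w) (wmon w))"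
proof (rule poly_mapping_eqI)
  fix v
  show "Poly_Mapping.lookup t v =
      Poly_Mapping.lookup (\<Sum>w\<in>Poly_Mapping.keys t. smul (Poly_Mapping.lookup t w) (wmon w)) v"
    by (simp add: lookup_sum lookup_smul lookup_wmon if_distrib [where f = "\<lambda>x. _ * x"]
        sum.delta' in_keys_iff cong: if_cong)
qed

lemma falg_induct [case_names zero add mon]:
  assumes "P 0" and "\<And>x y. P x \<Longrightarrow> P y \<Longrightarrow> P (x + y)" and "\<And>c w. P (smul c (wmon w))"
  shows "P t"
proof -
  have "P (\<Sum>w\<in>A. smul (f w) (wmon w))" for f and A :: "'a list set"
    by (induction A rule: infinite_finite_induct) (auto intro: assms)
  then show ?thesis by (subst falg_expand)
qed

lemma smul_mult_right: "x * smul c y = smul c (x * y)"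
proof (induction x rule: falg_induct)
  case (mon b u)
  show ?case
  proof (induction y rule: falg_induct)
    case (mon a v)
    show ?case by (simp add: wmon_def mult_single plus_list_def smul_def mult_ac)
  qed (simp_all add: algebra_simps falg.scale_right_distrib)
qed (simp_all add: algebra_simps falg.scale_right_distrib)

text \<open>Multiplication in the free algebra is convolution over the ways of cutting a word in two.\<close>

lemma lookup_mult_split:
  fixes x y :: "'a falg"
  shows "Poly_Mapping.lookup (x * y) w =
     (\<Sum>k\<le>length w. Poly_Mapping.lookup x (take k w) * Poly_Mapping.lookup y (drop k w))"
proof (induction x rule: falg_induct)
  case (mon b u)
  show ?case
  proof (induction y rule: falg_induct)
    case (mon a v)
    have "Poly_Mapping.lookup (wmon u) (take k w) * Poly_Mapping.lookup (wmon v) (drop k w)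
        = (if k = length u then (if w = u @ v then 1 else 0) else 0)" if "k \<le> length w" for k
    proof (cases "take k w = u \<and> drop k w = v")
      case True
      then have "w = u @ v" "k = length u"
        using append_take_drop_id [of k w] length_take [of k w] that by (metis, metis min.absorb2)
      then show ?thesis by (simp add: lookup_wmon)
    next
      case False
      then have "\<not> (k = length u \<and> w = u @ v)" by auto
      with False show ?thesis by (auto simp: lookup_wmon)
    qed
    then have "(\<Sum>k\<le>length w. Poly_Mapping.lookup (wmon u) (take k w) * Poly_Mapping.lookup (wmon v)
        (drop k w))
        = (\<Sum>k\<le>length w. if k = length u then (if w = u @ v then 1 else 0) else (0::complex))"
      by simp
    also have "\<dots> = Poly_Mapping.lookup (wmon u * wmon v) w"
      by (auto simp: wmon_mult lookup_wmon)
    finally have "(\<Sum>k\<le>length w. (b * a) * (Poly_Mapping.lookup (wmon u) (take k w) *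
        Poly_Mapping.lookup (wmon v) (drop k w))) = b * a * Poly_Mapping.lookup (wmon u * wmon v) w"
      by (simp only: sum_distrib_left [symmetric])
    then show ?case
      by (simp add: smul_mult_left smul_mult_right lookup_smul algebra_simps)
  qed (simp_all add: algebra_simps lookup_add sum.distrib)
qed (simp_all add: algebra_simps lookup_add sum.distrib)

lemma tens_lookup: "t \<in> tens k \<Longrightarrow> length w \<noteq> k \<Longrightarrow> Poly_Mapping.lookup t w = 0"
  by (auto simp: tens_def in_keys_iff)

lemma tensI: "(\<And>w. length w \<noteq> k \<Longrightarrow> Poly_Mapping.lookup t w = 0) \<Longrightarrow> t \<in> tens k"
  by (auto simp: tens_def in_keys_iff)

lemma lookup_mult_tens_left:
  assumes "x \<in> tens k" and "length u = k"
  shows "Poly_Mapping.lookup (x * y) (u @ v) = Poly_Mapping.lookup x u * Poly_Mapping.lookup y v"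
proof -
  have "Poly_Mapping.lookup (x * y) (u @ v) = (\<Sum>j\<le>length (u @ v).
      if j = k then Poly_Mapping.lookup x u * Poly_Mapping.lookup y v else 0)"
    unfolding lookup_mult_split using assms by (intro sum.cong) (auto simp: tens_lookup)
  then show ?thesis using assms by simp
qed

lemma lookup_mult_tens_right:
  assumes "y \<in> tens k" and "length v = k"
  shows "Poly_Mapping.lookup (x * y) (u @ v) = Poly_Mapping.lookup x u * Poly_Mapping.lookup y v"
proof -
  have "Poly_Mapping.lookup (x * y) (u @ v) = (\<Sum>j\<le>length (u @ v).
      if j = length u then Poly_Mapping.lookup x u * Poly_Mapping.lookup y v else 0)"
    unfolding lookup_mult_split using assms by (intro sum.cong) (auto simp: tens_lookup)
  then show ?thesis by simp
qed

lemma subspace_tens: "falg.subspace (tens k)"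
  by (intro falg.subspaceI tensI) (simp_all add: lookup_add lookup_smul tens_lookup)

lemma tens_wmon: "wmon w \<in> tens (length w)"
  by (auto simp: tens_def wmon_def)

lemma tens_mult:
  assumes "x \<in> tens j" and "y \<in> tens k"
  shows "x * y \<in> tens (j + k)"
proof (rule tensI)
  fix w :: "'a list" assume "length w \<noteq> j + k"
  then have "Poly_Mapping.lookup x (take i w) * Poly_Mapping.lookup y (drop i w) = 0"
    if "i \<le> length w" for i
    using that assms by (cases "i = j") (auto simp: tens_lookup)
  then show "Poly_Mapping.lookup (x * y) w = 0"
    unfolding lookup_mult_split by (intro sum.neutral) auto
qed

text \<open>The linear functional on the free algebra with prescribed values on words.\<close>

definition lfun :: "('a list \<Rightarrow> complex) \<Rightarrow> 'a falg \<Rightarrow> complex" where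
  "lfun c t = (\<Sum>w\<in>Poly_Mapping.keys t. c w * Poly_Mapping.lookup t w)"

lemma lfun_superset:
  assumes "finite S" "Poly_Mapping.keys t \<subseteq> S"
  shows "lfun c t = (\<Sum>w\<in>S. c w * Poly_Mapping.lookup t w)"
  unfolding lfun_def by (rule sum.mono_neutral_left) (use assms in \<open>auto simp: in_keys_iff\<close>)

lemma lfun_add: "lfun c (x + y) = lfun c x + lfun c y"
proof -
  have "lfun c z = (\<Sum>w\<in>Poly_Mapping.keys x \<union> Poly_Mapping.keys y. c w * Poly_Mapping.lookup z w)"
    if "z \<in> {x, y, x + y}" for z
    using that keys_add [of x y] by (intro lfun_superset) auto
  then show ?thesis by (simp add: lookup_add algebra_simps sum.distrib)
qed

lemma lfun_smul: "lfun c (smul a x) = a * lfun c x"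
proof -
  have "lfun c (smul a x) = (\<Sum>w\<in>Poly_Mapping.keys x. c w * Poly_Mapping.lookup (smul a x) w)"
    by (rule lfun_superset) (auto simp: in_keys_iff lookup_smul)
  then show ?thesis by (simp add: lfun_def lookup_smul sum_distrib_left mult_ac)
qed

lemma lfun_wmon: "lfun c (wmon w) = c w"
  by (simp add: lfun_def wmon_def)

lemma lfun_zero: "lfun c 0 = 0"
  by (simp add: lfun_def)

lemma lfun_uminus: "lfun c (- x) = - lfun c x"
  using lfun_add [of c x "- x"] by (simp add: lfun_zero eq_neg_iff_add_eq_0 add.commute)

lemma lfun_diff: "lfun c (x - y) = lfun c x - lfun c y"
  using lfun_add [of c x "- y"] by (simp add: lfun_uminus)

lemma lfun_sum: "lfun c (\<Sum>a\<in>A. x a) = (\<Sum>a\<in>A. lfun c (x a))"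
  by (induction A rule: infinite_finite_induct) (simp_all add: lfun_add lfun_zero)

lemma lfun_scale_fun: "lfun (\<lambda>w. a * c w) t = a * lfun c t"
  by (simp add: lfun_def sum_distrib_left mult_ac)

lemma lfun_add_fun: "lfun (\<lambda>w. c w + c' w) t = lfun c t + lfun c' t"
  by (simp add: lfun_def sum.distrib algebra_simps)

lemma lfun_zero_fun: "lfun (\<lambda>w. 0) t = 0"
  by (simp add: lfun_def)

lemma lfun_sum_fun: "lfun (\<lambda>w. \<Sum>a\<in>A. c a w) t = (\<Sum>a\<in>A. lfun (c a) t)"
  by (induction A rule: infinite_finite_induct) (simp_all add: lfun_add_fun lfun_zero_fun)

lemma lfun_cong:
  "t \<in> tens k \<Longrightarrow> (\<And>w. length w = k \<Longrightarrow> c w = c' w) \<Longrightarrow> lfun c t = lfun c' t"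
  unfolding lfun_def by (rule sum.cong) (auto simp: tens_def)

lemma lfun_mult_letter_left: "lfun c (wmon [i] * t) = lfun (\<lambda>w. c (i # w)) t"
  by (induction t rule: falg_induct)
    (simp_all add: lfun_zero lfun_add distrib_left smul_mult_right wmon_mult lfun_smul lfun_wmon)

lemma lfun_mult_letter_right: "lfun c (t * wmon [i]) = lfun (\<lambda>w. c (w @ [i])) t"
  by (induction t rule: falg_induct)
    (simp_all add: lfun_zero lfun_add distrib_right smul_mult_left wmon_mult lfun_smul lfun_wmon)

lemma lookup_linext: "Poly_Mapping.lookup (linext f t) w = lfun (\<lambda>u. Poly_Mapping.lookup (f u) w) t"
  by (simp add: linext_def lfun_def lookup_sum lookup_smul mult.commute)

lemma linext_wmon: "linext f (wmon w) = f w"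
  by (simp add: wmon_def linext_single)

lemma linext_smul: "linext f (smul c x) = smul c (linext f x)"
  by (rule poly_mapping_eqI) (simp add: lookup_linext lookup_smul lfun_smul)

lemma linext_zero: "linext f 0 = 0"
  by (simp add: linext_def)

lemma idx_sum: "(\<Sum>i\<in>UNIV. f i) = f I1 + f I0 + f Im1" for f :: "idx \<Rightarrow> 'b::ab_group_add"
  by (simp add: UNIV_idx add.assoc)

lemma length_2_conv: "length w = 2 \<longleftrightarrow> (\<exists>a b. w = [a, b])"
  by (auto simp: length_Suc_conv numeral_2_eq_2)

lemma lfun_tens2:
  fixes t :: "idx falg"
  assumes "t \<in> tens 2"
  shows "lfun c t = (\<Sum>i\<in>UNIV. \<Sum>j\<in>UNIV. c [i, j] * Poly_Mapping.lookup t [i, j])"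
proof -
  let ?h = "\<lambda>p. [fst p, snd p] :: idx list"
  have "Poly_Mapping.keys t \<subseteq> ?h ` UNIV"
    using assms by (fastforce simp: tens_def length_2_conv image_iff)
  then have "lfun c t = (\<Sum>w\<in>?h ` UNIV. c w * Poly_Mapping.lookup t w)"
    by (intro lfun_superset) auto
  also have "\<dots> = (\<Sum>p\<in>UNIV. c (?h p) * Poly_Mapping.lookup t (?h p))"
    by (subst sum.reindex) (auto simp: inj_on_def prod_eq_iff)
  also have "\<dots> = (\<Sum>i\<in>UNIV. \<Sum>j\<in>UNIV. c [i, j] * Poly_Mapping.lookup t [i, j])"
    by (subst sum.cartesian_product) (simp add: case_prod_beta)
  finally show ?thesis .
qed

section \<open>The braiding on the square of the adjoint module\<close>

text \<open>The braiding in coordinates: \<open>T i j\<close> is the coefficient of \<open>e\<^sub>i \<otimes> e\<^sub>j\<close>, and \<open>p\<close> stands for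
  \<open>q\<^sup>2\<close>. Its eigenvalues are \<open>p\<close> and \<open>1 / p\<^sup>2\<close> on the submodules of highest weight \<open>2 \<alpha>\<close> and \<open>0\<close>,
  and \<open>- 1 / p\<close> on the copy of the adjoint module. The values on \<open>e\<^sub>i \<otimes> e\<^sub>1\<close> and \<open>e\<^sub>-\<^sub>1 \<otimes> e\<^sub>j\<close> have no
  correction terms; the others follow from these by applying \<open>F\<close>.\<close>

fun braid :: "complex \<Rightarrow> (idx \<Rightarrow> idx \<Rightarrow> complex) \<Rightarrow> idx \<Rightarrow> idx \<Rightarrow> complex" where
  "braid p T I1 I1 = p * T I1 I1"
| "braid p T I1 I0 = T I0 I1 + (p - 1 / p) * T I1 I0"
| "braid p T I0 I1 = T I1 I0"
| "braid p T I1 Im1 = T Im1 I1 / p + (1 - 1 / p ^ 2) * T I0 I0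
     + (p - 1 / p) * (1 - 1 / p) * T I1 Im1"
| "braid p T I0 I0 = T I0 I0 + (p - 1 / p) * T I1 Im1"
| "braid p T Im1 I1 = T I1 Im1 / p"
| "braid p T I0 Im1 = T Im1 I0 + (p - 1 / p) * T I0 Im1"
| "braid p T Im1 I0 = T I0 Im1"
| "braid p T Im1 Im1 = p * T Im1 Im1"

text \<open>The action of a generator of \<open>U\<^sub>q(sl(2))\<close> on the square of the adjoint module, in the same
  coordinates.\<close>

definition act2 :: "real \<Rightarrow> uq_gen \<Rightarrow> (idx \<Rightarrow> idx \<Rightarrow> complex) \<Rightarrow> idx \<Rightarrow> idx \<Rightarrow> complex" where
  "act2 q g T a b =
     (if g = E1 then (\<Sum>i\<in>UNIV. u_plus_mat q E1 a i * T i b) +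
        (\<Sum>i\<in>UNIV. \<Sum>j\<in>UNIV. u_plus_mat q K1 a i * u_plus_mat q E1 b j * T i j)
      else if g = F1 then (\<Sum>i\<in>UNIV. \<Sum>j\<in>UNIV. u_plus_mat q F1 a i * u_plus_mat q K1inv b j * T i j) +
        (\<Sum>j\<in>UNIV. u_plus_mat q F1 b j * T a j)
      else (\<Sum>i\<in>UNIV. \<Sum>j\<in>UNIV. u_plus_mat q g a i * u_plus_mat q g b j * T i j))"

lemma braid_act2:
  assumes "q > 0" and "g \<in> {K1, K1inv, E1, F1}"
  shows "braid (of_real (q ^ 2)) (act2 q g T) a b = act2 q g (braid (of_real (q ^ 2)) T) a b"
proof -
  define s :: complex where "s = of_real (sqrt (q + inverse q))"
  define p :: complex where "p = of_real (q ^ 2)"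
  have p: "p \<noteq> 0" "(complex_of_real q)\<^sup>2 = p" "complex_of_real q powi -2 = 1 / p"
    using assms by (auto simp: p_def power_int_minus divide_inverse)
  show ?thesis
    unfolding p_def [symmetric] using assms(2)
    by (cases a; cases b; auto simp: act2_def idx_sum p s_def [symmetric])
      (simp_all add: field_simps p(1) power2_eq_square)
qed

lemma braid_linear:
  "braid p (\<lambda>i j. x * T i j + y * T' i j) a b = x * braid p T a b + y * braid p T' a b"
  by (cases a; cases b) (simp_all add: algebra_simps add_divide_distrib)

text \<open>Coordinate equations of the span of the eigenvectors with positive eigenvalue, respectively
  with negative eigenvalue.\<close>

definition sym_eqs :: "complex \<Rightarrow> (idx \<Rightarrow> idx \<Rightarrow> complex) \<Rightarrow> bool" where
  "sym_eqs p T \<longleftrightarrow> T I1 I0 = p * T I0 I1 \<and> T I0 Im1 = p * T Im1 I0 \<and>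
     T Im1 I1 = T I1 Im1 + (1 / p - 1) * T I0 I0"

definition alt_eqs :: "complex \<Rightarrow> (idx \<Rightarrow> idx \<Rightarrow> complex) \<Rightarrow> bool" where
  "alt_eqs p T \<longleftrightarrow> T I1 I1 = 0 \<and> T Im1 Im1 = 0 \<and> T I0 I1 = - p * T I1 I0 \<and>
     T Im1 I0 = - p * T I0 Im1 \<and> T Im1 I1 = - T I1 Im1 \<and> T I0 I0 = (1 - p) * T I1 Im1"

lemma sym_eqs_mult: "sym_eqs p T \<Longrightarrow> sym_eqs p (\<lambda>a b. c * T a b)"
  unfolding sym_eqs_def by (auto simp: distrib_left)

lemma sym_eqs_add: "sym_eqs p T \<Longrightarrow> sym_eqs p T' \<Longrightarrow> sym_eqs p (\<lambda>a b. T a b + T' a b)"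
  unfolding sym_eqs_def by (auto simp: distrib_left)

lemma alt_eqs_mult: "alt_eqs p T \<Longrightarrow> alt_eqs p (\<lambda>a b. c * T a b)"
  unfolding alt_eqs_def by auto

lemma alt_eqs_add: "alt_eqs p T \<Longrightarrow> alt_eqs p T' \<Longrightarrow> alt_eqs p (\<lambda>a b. T a b + T' a b)"
  unfolding alt_eqs_def by (auto simp: distrib_left)

lemma sym_eqs_cancel: "c \<noteq> 0 \<Longrightarrow> sym_eqs p (\<lambda>a b. c * T a b) \<Longrightarrow> sym_eqs p T"
  using sym_eqs_mult [of p "\<lambda>a b. c * T a b" "inverse c"] by (simp add: mult.assoc [symmetric])

lemma alt_eqs_cancel: "c \<noteq> 0 \<Longrightarrow> alt_eqs p (\<lambda>a b. c * T a b) \<Longrightarrow> alt_eqs p T"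
  using alt_eqs_mult [of p "\<lambda>a b. c * T a b" "inverse c"] by (simp add: mult.assoc [symmetric])

text \<open>The three eigenvalues give a product of three factors that annihilates the braiding \<open>R\<close>:
  the image of \<open>R + 1 / p\<close> satisfies the symmetric equations, on their solutions \<open>(R - p) (R - 1
  / p\<^sup>2) = 0\<close>, and the image of \<open>(R - p) (R - 1 / p\<^sup>2)\<close> satisfies the antisymmetric equations. So
  the eigenspaces need not be spanned by hand.\<close>

lemma sym_eqs_image:
  assumes "p \<noteq> 0"
  shows "sym_eqs p (\<lambda>a b. braid p T a b + T a b / p)"
  using assms by (simp add: sym_eqs_def field_simps power2_eq_square)

lemma braid_braid_sym:
  assumes "p \<noteq> 0" and "sym_eqs p T"
  shows "braid p (braid p T) a b = (p + 1 / p ^ 2) * braid p T a b - T a b / p"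
proof -
  have T: "T I1 I0 = p * T I0 I1" "T I0 Im1 = p * T Im1 I0"
     "T Im1 I1 = T I1 Im1 + (1 / p - 1) * T I0 I0"
    using assms(2) by (auto simp: sym_eqs_def algebra_simps)
  show ?thesis
    by (cases a; cases b; simp add: T) (simp_all add: assms(1) field_simps power2_eq_square)
qed

lemma alt_eqs_image:
  assumes "p \<noteq> 0"
  shows "alt_eqs p (\<lambda>a b. braid p (braid p T) a b - (p + 1 / p ^ 2) * braid p T a b + T a b / p)"
  using assms by (simp add: alt_eqs_def field_simps power2_eq_square)

lemma braid_alt:
  assumes "p \<noteq> 0" and "alt_eqs p T"
  shows "braid p T a b = - T a b / p"
  using assms(2) by (cases a; cases b; simp add: alt_eqs_def)
      (simp_all add: assms(1) field_simps power2_eq_square)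

lemma vec_tens: "vec M g i \<in> tens 1"
  by (rule tensI) (auto simp: vec_def lookup_sum lookup_single when_def intro!: sum.neutral)

lemma gen_on_word_tens: "gen_on_word M g w \<in> tens (length w)"
proof (induction w arbitrary: g)
  case Nil
  show ?case by (rule tensI) (simp add: lookup_one zero_list_def when_def)
next
  case (Cons i w)
  have *: "vec M h i * x \<in> tens (Suc (length w))" if "x \<in> tens (length w)" for h x
    using tens_mult [OF vec_tens that] by simp
  have **: "wmon [i] * x \<in> tens (Suc (length w))" if "x \<in> tens (length w)" for x
    using tens_mult [OF tens_wmon that, of "[i]"] by simp
  note add = falg.subspace_add [OF subspace_tens]
  show ?case
    by (auto intro!: * ** add Cons tens_wmon)
qed

lemma linext_tens:
  assumes "t \<in> tens k" and "\<And>w. length w = k \<Longrightarrow> f w \<in> tens m"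
  shows "linext f t \<in> tens m"
  unfolding linext_def
  by (intro falg.subspace_sum [OF subspace_tens] falg.subspace_scale [OF subspace_tens] assms(2))
    (use assms(1) in \<open>auto simp: tens_def\<close>)

lemma gen_act_tens: "t \<in> tens k \<Longrightarrow> linext (gen_on_word M g) t \<in> tens k"
  using gen_on_word_tens by (metis linext_tens)

lemma uq_word_act_tens: "t \<in> tens k \<Longrightarrow> foldr (\<lambda>g. linext (gen_on_word M g)) u t \<in> tens k"
  by (induction u) (auto intro: gen_act_tens)

lemma lookup_vec_mult_vec: "Poly_Mapping.lookup (vec M g i * vec M h j) [a, b] = mat M g a i * mat M h b j"
  using lookup_mult_tens_left [OF vec_tens, of "[a]" M g i "vec M h j" "[b]"] by (simp add: lookup_vec)

lemma lookup_gen_on_pair: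
  "Poly_Mapping.lookup (gen_on_word M g [i, j]) [a, b] =
     (if g = E1 then mat M E1 a i * (if b = j then 1 else 0) + mat M K1 a i * mat M E1 b j
      else if g = F1 then mat M F1 a i * mat M K1inv b j + (if a = i then 1 else 0) * mat M F1 b j
      else mat M g a i * mat M g b j)"
proof -
  have "Poly_Mapping.lookup (vec M g i * wmon [j]) [a, b] = mat M g a i * (if b = j then 1 else 0)" for g
    using lookup_mult_tens_left [OF vec_tens, of "[a]" M g i "wmon [j]" "[b]"] by
        (simp add: lookup_vec lookup_wmon)
  moreover have "Poly_Mapping.lookup (wmon [i] * vec M g j) [a, b] = (if a =
      i then 1 else 0) * mat M g b j" for g
    using lookup_mult_tens_left [OF tens_wmon, of "[a]" "[i]" "vec M g j" "[b]"] by
        (simp add: lookup_vec lookup_wmon)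
  ultimately show ?thesis
    by (subst gen_on_word.simps(2))
      (simp only: gen_on_basis lookup_add lookup_vec_mult_vec if_distrib [where f =
          "\<lambda>x. Poly_Mapping.lookup x [a, b]"] cong: if_cong)
qed

lemma span_words2:
  assumes "x \<in> tens 2" and "\<And>a b. \<not> P a b \<Longrightarrow> Poly_Mapping.lookup x [a, b] = 0"
  shows "x \<in> falg.span {wmon [a, b] | a b. P a b}"
proof (subst falg_expand, intro falg.span_sum falg.span_scale falg.span_base)
  fix w assume w: "w \<in> Poly_Mapping.keys x"
  then obtain a b where "w = [a, b]" using assms(1) by (auto simp: tens_def length_2_conv)
  with w assms(2) have "P a b" by (auto simp: in_keys_iff)
  then show "wmon w \<in> {wmon [a, b] | a b. P a b}" using \<open>w = [a, b]\<close> by auto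
qed

text \<open>The properties that characterize the braiding of a module with itself.\<close>

definition is_braiding :: "real \<Rightarrow> uq_module \<Rightarrow> (idx falg \<Rightarrow> idx falg) \<Rightarrow> bool" where
  "is_braiding q M R \<longleftrightarrow> R \<in> extensional (tens 2) \<and> R \<in> tens 2 \<rightarrow> tens 2 \<and> linear_on (tens 2) R \<and>
     (\<forall>X\<in>uq_sl2. \<forall>t\<in>tens 2. R (uq_act M X t) = uq_act M X (R t)) \<and>
     (\<forall>i j. R (wmon [i, j]) - smul (of_real (q powi (2 * weight M i * weight M j))) (wmon [j, i])
        \<in> falg.span {wmon [a, b] | a b. weight M a > weight M j \<and> weight M b < weight M i})"

text \<open>A module that becomes the adjoint module in the basis \<open>e i = d i v (\<sigma> i)\<close>, where \<open>v\<close> is its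
  given basis. Both \<open>u_plus\<close> (with \<open>\<sigma> = id\<close> and \<open>d = 1\<close>) and its dual are of this form, so that
  each of the following facts is proved for the two at once.\<close>

locale adjoint_module =
  fixes q :: real and M :: uq_module and \<sigma> :: "idx \<Rightarrow> idx" and d :: "idx \<Rightarrow> complex"
  assumes q_pos: "0 < q" and q_less_1: "q < 1"
    and sigma_sigma: "\<sigma> (\<sigma> i) = i"
    and d_nonzero: "d i \<noteq> 0"
    and weight_sigma: "weight M (\<sigma> i) = idx_wt i"
    and mat_sigma: "g \<in> {K1, K1inv, E1, F1} \<Longrightarrow>
      mat M g (\<sigma> j) (\<sigma> i) = u_plus_mat q g j i * d j / d i"
begin

definition p :: complex where "p = of_real (q ^ 2)"

lemma p_nonzero: "p \<noteq> 0"
  using q_pos by (simp add: p_def)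

lemma sigma_eq_iff: "\<sigma> i = \<sigma> j \<longleftrightarrow> i = j"
  by (metis sigma_sigma)

lemma bij_sigma: "bij \<sigma>"
  by (rule o_bij [of \<sigma>]) (auto simp: sigma_sigma)

lemma sum_sigma: "(\<Sum>i\<in>UNIV. f i) = (\<Sum>i\<in>UNIV. f (\<sigma> i))"
  using sum.reindex_bij_betw [OF bij_sigma, of f] by simp

lemma ex_sigma: "\<exists>j. i = \<sigma> j"
  by (metis sigma_sigma)

text \<open>Coordinates with respect to the rescaled basis vectors.\<close>

definition coord :: "idx falg \<Rightarrow> idx \<Rightarrow> idx \<Rightarrow> complex" where
  "coord t i j = Poly_Mapping.lookup t [\<sigma> i, \<sigma> j] / (d i * d j)"

definition of_coord :: "(idx \<Rightarrow> idx \<Rightarrow> complex) \<Rightarrow> idx falg" where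
  "of_coord T = (\<Sum>i\<in>UNIV. \<Sum>j\<in>UNIV. smul (d i * d j * T i j) (wmon [\<sigma> i, \<sigma> j]))"

lemma of_coord_tens: "of_coord T \<in> tens 2"
  unfolding of_coord_def
  by (intro falg.subspace_sum [OF subspace_tens] falg.subspace_scale [OF subspace_tens])
    (metis tens_wmon length_2_conv)

lemma coord_of_coord: "coord (of_coord T) = T"
proof (intro ext)
  fix a b
  have "Poly_Mapping.lookup (of_coord T) [\<sigma> a, \<sigma> b] =
      (\<Sum>i\<in>UNIV. \<Sum>j\<in>UNIV. if a = i then if b = j then d a * d b * T a b else 0 else 0)"
    unfolding of_coord_def
    by (auto simp: lookup_sum lookup_smul lookup_wmon sigma_eq_iff intro!: sum.cong)
  also have "\<dots> = d a * d b * T a b"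
    by (cases a; cases b; simp add: idx_sum)
  finally show "coord (of_coord T) a b = T a b" by (simp add: coord_def d_nonzero)
qed

lemma coord_inject:
  assumes "x \<in> tens 2" "y \<in> tens 2" "coord x = coord y"
  shows "x = y"
proof (rule poly_mapping_eqI)
  fix w
  show "Poly_Mapping.lookup x w = Poly_Mapping.lookup y w"
  proof (cases "length w = 2")
    case True
    then obtain a b where "w = [\<sigma> a, \<sigma> b]" by (metis length_2_conv ex_sigma)
    then show ?thesis
      using fun_cong [OF fun_cong [OF assms(3)], of a b] by (simp add: coord_def d_nonzero)
  qed (use assms in \<open>simp add: tens_lookup\<close>)
qed

lemma coord_add: "coord (x + y) i j = coord x i j + coord y i j"
  by (simp add: coord_def lookup_add add_divide_distrib)

lemma coord_diff: "coord (x - y) i j = coord x i j - coord y i j"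
  by (simp add: coord_def lookup_minus diff_divide_distrib)

lemma coord_smul: "coord (smul c x) i j = c * coord x i j"
  by (simp add: coord_def lookup_smul)

lemma coord_gen_act:
  assumes "t \<in> tens 2" and g: "g \<in> {K1, K1inv, E1, F1}"
  shows "coord (linext (gen_on_word M g) t) = act2 q g (coord t)"
proof (intro ext)
  fix a b
  note m = mat_sigma [OF g] mat_sigma [of K1] mat_sigma [of K1inv] mat_sigma [of E1] mat_sigma [of F1]
  have "Poly_Mapping.lookup (linext (gen_on_word M g) t) [\<sigma> a, \<sigma> b] =
     (\<Sum>i\<in>UNIV. \<Sum>j\<in>UNIV. Poly_Mapping.lookup (gen_on_word M g [\<sigma> i, \<sigma> j]) [\<sigma> a, \<sigma> b] *
        Poly_Mapping.lookup t [\<sigma> i, \<sigma> j])"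
    unfolding lookup_linext lfun_tens2 [OF assms(1)]
    by (subst sum_sigma, rule sum.cong [OF refl], subst sum_sigma, rule refl)
  then show "coord (linext (gen_on_word M g) t) a b = act2 q g (coord t) a b"
    by (cases a; cases b)
      (use g in \<open>auto simp: coord_def lookup_gen_on_pair sigma_eq_iff act2_def idx_sum m d_nonzero
        simp del: gen_on_word.simps\<close>,
       simp_all add: field_simps d_nonzero)
qed

definition braid_map :: "idx falg \<Rightarrow> idx falg" where
  "braid_map = restrict (\<lambda>t. of_coord (braid p (coord t))) (tens 2)"

lemma coord_braid_map: "t \<in> tens 2 \<Longrightarrow> coord (braid_map t) = braid p (coord t)"
  by (simp add: braid_map_def coord_of_coord)

lemma braid_map_tens: "t \<in> tens 2 \<Longrightarrow> braid_map t \<in> tens 2"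
  by (simp add: braid_map_def of_coord_tens)

lemma braid_map_add:
  assumes "x \<in> tens 2" "y \<in> tens 2"
  shows "braid_map (x + y) = braid_map x + braid_map y"
proof (rule coord_inject)
  have xy: "x + y \<in> tens 2" using assms by (rule falg.subspace_add [OF subspace_tens])
  show "coord (braid_map (x + y)) = coord (braid_map x + braid_map y)"
    using braid_linear [of p 1 "coord x" 1 "coord y"]
    by (intro ext) (simp add: coord_braid_map assms xy coord_add [abs_def])
qed (auto intro!: braid_map_tens falg.subspace_add [OF subspace_tens] assms)

lemma braid_map_smul:
  assumes "x \<in> tens 2"
  shows "braid_map (smul c x) = smul c (braid_map x)"
proof (rule coord_inject)
  have x: "smul c x \<in> tens 2" using assms by (rule falg.subspace_scale [OF subspace_tens])
  show "coord (braid_map (smul c x)) = coord (smul c (braid_map x))"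
    using braid_linear [of p c "coord x" 0 "coord x"]
    by (intro ext) (simp add: coord_braid_map assms x coord_smul [abs_def])
qed (auto intro!: braid_map_tens falg.subspace_scale [OF subspace_tens] assms)

lemma braid_map_gen_act:
  assumes "t \<in> tens 2" and "g \<in> {K1, K1inv, E1, F1}"
  shows "braid_map (linext (gen_on_word M g) t) = linext (gen_on_word M g) (braid_map t)"
proof (rule coord_inject)
  show "coord (braid_map (linext (gen_on_word M g) t)) = coord (linext (gen_on_word M g) (braid_map t))"
    using braid_act2 [OF q_pos assms(2), folded p_def]
    by (intro ext) (simp add: coord_braid_map coord_gen_act [OF _ assms(2)] assms(1) gen_act_tens
        braid_map_tens)
qed (auto intro!: braid_map_tens gen_act_tens assms)

lemma braid_map_sum:
  assumes "\<And>a. a \<in> A \<Longrightarrow> x a \<in> tens 2"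
  shows "braid_map (\<Sum>a\<in>A. x a) = (\<Sum>a\<in>A. braid_map (x a))"
proof -
  have "braid_map 0 = 0"
    using braid_map_smul [of 0 0] falg.subspace_0 [OF subspace_tens [where ?'a = idx]] by simp
  then show ?thesis using assms
    by (induction A rule: infinite_finite_induct)
      (auto simp: braid_map_add falg.subspace_sum [OF subspace_tens])
qed

lemma is_braiding_braid_map: "is_braiding q M braid_map"
  unfolding is_braiding_def
proof (intro conjI ballI allI)
  show "braid_map \<in> extensional (tens 2)" by (simp add: braid_map_def)
  show "braid_map \<in> tens 2 \<rightarrow> tens 2" by (auto intro: braid_map_tens)
  show "linear_on (tens 2) braid_map" by (auto simp: linear_on_def braid_map_add braid_map_smul)
next
  fix X t assume X: "X \<in> uq_sl2" and t: "t \<in> (tens 2 :: idx falg set)"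
  let ?a = "\<lambda>u t. foldr (\<lambda>g. linext (gen_on_word M g)) u t"
  have word: "braid_map (?a u t) = ?a u (braid_map t)" if "set u \<subseteq> {K1, K1inv, E1, F1}" for u
    using that by (induction u) (simp_all add: braid_map_gen_act uq_word_act_tens t)
  show "braid_map (uq_act M X t) = uq_act M X (braid_map t)"
    unfolding uq_act_def
    by (subst braid_map_sum)
      (use X in \<open>auto intro!: sum.cong falg.subspace_scale [OF subspace_tens] uq_word_act_tens t
        simp: braid_map_smul uq_word_act_tens t word uq_sl2_def\<close>)
next
  fix i' j'
  obtain i j where ij: "i' = \<sigma> i" "j' = \<sigma> j" using ex_sigma by metis
  have tens: "wmon [\<sigma> i, \<sigma> j] \<in> tens 2" for i j by (metis tens_wmon length_2_conv)
  let ?c = "complex_of_real (q powi (2 * weight M i' * weight M j'))"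
  let ?x = "braid_map (wmon [i', j']) - smul ?c (wmon [j', i'])"
  have coord_wmon: "coord (wmon [\<sigma> i, \<sigma> j]) a b = (if a = i \<and> b =
      j then 1 / (d i * d j) else 0)" for i j a b
    by (simp add: coord_def lookup_wmon sigma_eq_iff)
  show "?x \<in> falg.span {wmon [a, b] | a b. weight M a > weight M j' \<and> weight M b < weight M i'}"
  proof (rule span_words2)
    show "?x \<in> tens 2"
      unfolding ij by (intro falg.subspace_diff [OF subspace_tens] falg.subspace_scale [OF subspace_tens]
        braid_map_tens tens)
    fix a' b' assume *: "\<not> (weight M a' > weight M j' \<and> weight M b' < weight M i')"
    obtain a b where ab: "a' = \<sigma> a" "b' = \<sigma> b" using ex_sigma by metis
    have "coord ?x a b = 0"
      unfolding ij coord_diff coord_smul coord_braid_map [OF tens]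
      using * q_pos d_nonzero unfolding ij ab weight_sigma
      by (cases i; cases j; cases a; cases b)
        (simp_all add: coord_wmon p_def power_int_minus divide_inverse weight_sigma)
    then show "Poly_Mapping.lookup ?x [a', b'] = 0"
      by (simp add: coord_def d_nonzero ab)
  qed
qed

end

context adjoint_module
begin

text \<open>The tensor \<open>e\<^sub>i \<otimes> e\<^sub>j\<close>.\<close>

definition unit2 :: "idx \<Rightarrow> idx \<Rightarrow> idx falg" where
  "unit2 i j = of_coord (\<lambda>a b. if a = i \<and> b = j then 1 else 0)"

lemma coord_unit2: "coord (unit2 i j) a b = (if a = i \<and> b = j then 1 else 0)"
  by (simp add: unit2_def coord_of_coord)

lemma unit2_eq: "unit2 i j = smul (d i * d j) (wmon [\<sigma> i, \<sigma> j])"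
  by (rule coord_inject)
    (auto simp: unit2_def coord_of_coord of_coord_tens coord_def lookup_smul lookup_wmon
        sigma_eq_iff d_nonzero
      intro!: falg.subspace_scale [OF subspace_tens] ext split: if_splits,
     metis tens_wmon length_2_conv)

lemma unit2_tens: "unit2 i j \<in> tens 2"
  by (simp add: unit2_def of_coord_tens)

lemma unit2_expand:
  assumes "t \<in> tens 2"
  shows "t = (\<Sum>i\<in>UNIV. \<Sum>j\<in>UNIV. smul (coord t i j) (unit2 i j))"
proof (rule coord_inject [OF assms])
  have eq: "(\<Sum>i\<in>UNIV. \<Sum>j\<in>UNIV. smul (coord t i j) (unit2 i j)) = of_coord (coord t)"
    by (simp add: of_coord_def unit2_eq mult_ac)
  show "coord t = coord (\<Sum>i\<in>UNIV. \<Sum>j\<in>UNIV. smul (coord t i j) (unit2 i j))"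
    by (simp add: eq coord_of_coord)
  show "(\<Sum>i\<in>UNIV. \<Sum>j\<in>UNIV. smul (coord t i j) (unit2 i j)) \<in> tens 2"
    by (simp add: eq of_coord_tens)
qed

text \<open>The weight condition determines the braiding on \<open>v \<otimes> v\<^sub>1\<close> and \<open>v\<^sub>-\<^sub>1 \<otimes> v\<close>, and these vectors
  generate the tensor square under the action of \<open>F\<close>.\<close>

lemma F_closed_subspace_eq_tens2:
  assumes U: "falg.subspace U" and F: "\<And>t. t \<in> U \<Longrightarrow> t \<in> tens 2 \<Longrightarrow> linext (gen_on_word M F1) t \<in> U"
    and right: "\<And>i. unit2 i I1 \<in> U" and left: "\<And>j. unit2 Im1 j \<in> U"
  shows "tens 2 \<subseteq> U"
proof -
  define s where "s = complex_of_real (sqrt (q + inverse q))"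
  have s: "s \<noteq> 0" using q_pos by (simp add: s_def add_nonneg_eq_0_iff)
  let ?F = "linext (gen_on_word M F1)"
  have cF: "coord (?F (unit2 i j)) = act2 q F1 (coord (unit2 i j))" for i j
    by (simp add: coord_gen_act unit2_tens)
  have Ft: "?F (unit2 i j) \<in> tens 2" for i j by (simp add: gen_act_tens unit2_tens)
  note sub = falg.subspace_diff [OF subspace_tens] falg.subspace_scale [OF subspace_tens] Ft unit2_tens
  note ext9 = coord_diff coord_smul cF coord_unit2 act2_def idx_sum s_def [symmetric] s
  have eq: "unit2 I1 I0 = smul (1 / s) (?F (unit2 I1 I1)) - smul (of_real (q powi -2)) (unit2 I0 I1)"
    "unit2 I0 I0 = smul (1 / s) (?F (unit2 I0 I1)) - smul (of_real (q powi -2)) (unit2 Im1 I1)"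
    "unit2 I1 Im1 = smul (1 / s) (?F (unit2 I1 I0)) - unit2 I0 I0"
    "unit2 I0 Im1 = smul (1 / s) (?F (unit2 I0 I0)) - unit2 Im1 I0"
    by (rule coord_inject; (intro sub)?; intro ext; rename_tac a b; case_tac a; case_tac b; simp add: ext9)+
  note U' = falg.subspace_diff [OF U] falg.subspace_scale [OF U] F unit2_tens
  have 1: "unit2 I1 I0 \<in> U" by (subst eq) (intro U' right)
  have 2: "unit2 I0 I0 \<in> U" by (subst eq) (intro U' right)
  have 3: "unit2 I1 Im1 \<in> U" by (subst eq) (intro U' 1 2)
  have 4: "unit2 I0 Im1 \<in> U" by (subst eq) (intro U' 2 left)
  \<comment> \<open>The remaining five vectors lie in \<open>U\<close> by assumption.\<close>
  have all: "unit2 i j \<in> U" for i j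
    using 1 2 3 4 right left by (cases i; cases j) auto
  show ?thesis
  proof
    fix t :: "idx falg" assume "t \<in> tens 2"
    then show "t \<in> U"
      by (subst unit2_expand) (auto intro!: falg.subspace_sum [OF U] falg.subspace_scale [OF U] all)
  qed
qed

lemma is_braiding_unique:
  assumes "is_braiding q M R" and "is_braiding q M R'"
  shows "R = R'"
proof -
  define U where "U = {t \<in> tens 2. R t = R' t}"
  note R = assms [unfolded is_braiding_def linear_on_def]
  have U: "falg.subspace U"
  proof (rule falg.subspaceI)
    have "R 0 = 0" "R' 0 = 0"
      using R falg.subspace_0 [OF subspace_tens [where ?'a = idx]] by (metis falg.scale_zero_left)+
    then show "0 \<in> U" using falg.subspace_0 [OF subspace_tens] by (simp add: U_def)
  qed (use R in \<open>auto simp: U_def falg.subspace_add [OF subspace_tens] falg.subspace_scale [OF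
      subspace_tens]\<close>)
  have wt: "idx_wt i \<le> 1" "idx_wt i \<ge> -1" for i by (cases i; simp)+
  have extreme: "wmon [i, j] \<in> U" if "j = \<sigma> I1 \<or> i = \<sigma> Im1" for i j
  proof -
    \<comment> \<open>No weight exceeds that of \<open>e\<^sub>1\<close> or lies below that of \<open>e\<^sub>-\<^sub>1\<close>, so the correction terms vanish.\<close>
    have "\<not> (weight M a > weight M j \<and> weight M b < weight M i)" for a b
      using that ex_sigma [of a] ex_sigma [of b] wt by (auto simp: weight_sigma not_less)
    then have empty: "{wmon [a, b] | a b. weight M a > weight M j \<and> weight M b < weight M i} = {}" by auto
    have det: "S (wmon [i, j]) = smul (of_real (q powi (2 * weight M i * weight M j))) (wmon [j, i])"
      if "is_braiding q M S" for S
    proof -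
      from that have "S (wmon [i, j]) - smul (of_real (q powi (2 * weight M i * weight M j))) (wmon [j, i])
          \<in> falg.span {wmon [a, b] | a b. weight M a > weight M j \<and> weight M b < weight M i}"
        by (simp add: is_braiding_def)
      then show ?thesis unfolding empty by simp
    qed
    then show ?thesis
      using det [OF assms(1)] det [OF assms(2)] tens_wmon [of "[i, j]"] by (simp add: U_def numeral_2_eq_2)
  qed
  have "tens 2 \<subseteq> U"
  proof (rule F_closed_subspace_eq_tens2 [OF U])
    have F: "wmon [F1] \<in> uq_sl2" by (auto simp: uq_sl2_def wmon_def)
    show "linext (gen_on_word M F1) t \<in> U" if "t \<in> U" "t \<in> tens 2" for t
    proof -
      have comm: "S (linext (gen_on_word M F1) t) = linext (gen_on_word M F1) (S t)"
        if "is_braiding q M S" for S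
        using that F \<open>t \<in> tens 2\<close> uq_act_mon [of M "[F1]"] unfolding is_braiding_def by fastforce
      from that show ?thesis by (simp add: U_def gen_act_tens comm [OF assms(1)] comm [OF assms(2)])
    qed
  qed (simp_all add: unit2_eq falg.subspace_scale [OF U] extreme)
  then have "R t = R' t" if "t \<in> tens 2" for t using that by (auto simp: U_def)
  then show ?thesis using R by (intro extensionalityI [of R "tens 2" R']) auto
qed

lemma braiding_eq: "braiding q M = braid_map"
  unfolding braiding_def is_braiding_def [symmetric]
  by (rule the_equality) (auto intro: is_braiding_braid_map is_braiding_unique)

lemma p_neq: "p \<noteq> 1 / p ^ 2"
proof -
  have "q ^ 6 < 1" using q_pos q_less_1 by (simp add: power_less_one_iff)
  then have "p ^ 3 \<noteq> 1"
    unfolding p_def of_real_power [symmetric] power_mult [symmetric] by (simp del: of_real_power)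
  then show ?thesis using p_nonzero by (simp add: field_simps power2_eq_square power3_eq_cube)
qed

lemma braid_map_eigen:
  assumes "t \<in> tens 2"
  shows "braid_map t = smul c t \<longleftrightarrow> (\<forall>a b. braid p (coord t) a b = c * coord t a b)"
proof
  assume "braid_map t = smul c t"
  then show "\<forall>a b. braid p (coord t) a b = c * coord t a b"
    using coord_braid_map [OF assms] coord_smul by metis
next
  assume "\<forall>a b. braid p (coord t) a b = c * coord t a b"
  then show "braid_map t = smul c t"
    by (intro coord_inject braid_map_tens falg.subspace_scale [OF subspace_tens] assms ext)
      (simp add: coord_braid_map assms coord_smul)
qed

lemma coord_0: "coord 0 = (\<lambda>i j. 0)"
  by (intro ext) (simp add: coord_def)

lemma subspace_sym: "falg.subspace {t \<in> tens 2. sym_eqs p (coord t)}"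
  by (rule falg.subspaceI)
    (auto simp: sym_eqs_add sym_eqs_mult coord_0 coord_add [abs_def] coord_smul [abs_def]
      falg.subspace_0 [OF subspace_tens] falg.subspace_add [OF subspace_tens]
      falg.subspace_scale [OF subspace_tens], simp add: sym_eqs_def)

lemma subspace_alt: "falg.subspace {t \<in> tens 2. alt_eqs p (coord t)}"
  by (rule falg.subspaceI)
    (auto simp: alt_eqs_add alt_eqs_mult coord_0 coord_add [abs_def] coord_smul [abs_def]
      falg.subspace_0 [OF subspace_tens] falg.subspace_add [OF subspace_tens]
      falg.subspace_scale [OF subspace_tens], simp add: alt_eqs_def)

lemma of_real_inverse_p: "of_real (inverse (q ^ 4)) = 1 / p ^ 2"
  by (simp add: p_def divide_inverse flip: power_mult)

text \<open>On solutions of the symmetric equations \<open>R t - x t\<close>, for \<open>x\<close> one of the two positive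
  eigenvalues, is an eigenvector for the other one, and \<open>t\<close> is a combination of the two tensors
  so obtained.\<close>

lemma sym2_eq: "sym2 q M = {t \<in> tens 2. sym_eqs p (coord t)}"
proof
  show "sym2 q M \<subseteq> {t \<in> tens 2. sym_eqs p (coord t)}"
    unfolding sym2_def braiding_eq
  proof (rule falg.span_minimal [OF _ subspace_sym], safe)
    fix t and \<mu> :: real assume t: "t \<in> tens 2" "\<mu> > 0" "braid_map t = smul (of_real \<mu>) t"
    have "\<mu> + 1 / q ^ 2 > 0" using t(2) q_pos by (simp add: add_pos_pos)
    then have "of_real (\<mu> + 1 / q ^ 2) \<noteq> (0 :: complex)" by (simp only: of_real_eq_0_iff)
    then have c: "of_real \<mu> + 1 / p \<noteq> 0" by (simp add: p_def)
    have "sym_eqs p (\<lambda>a b. (of_real \<mu> + 1 / p) * coord t a b)"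
      using sym_eqs_image [OF p_nonzero, of "coord t"] t braid_map_eigen [OF t(1)]
      by (simp add: distrib_right)
    then show "sym_eqs p (coord t)" using c by (rule sym_eqs_cancel [rotated])
  qed
next
  show "{t \<in> tens 2. sym_eqs p (coord t)} \<subseteq> sym2 q M"
  proof safe
    fix t assume t: "t \<in> tens 2" "sym_eqs p (coord t)"
    have eigen: "braid_map t - smul x t \<in> sym2 q M" if xy: "x * of_real y = 1 / p" "x + of_real y =
        p + 1 / p ^ 2" "y > 0" for x y
    proof (cases "braid_map t - smul x t = 0")
      case False
      have bb: "braid p (braid p (coord t)) a b =
          (x + of_real y) * braid p (coord t) a b - x * of_real y * coord t a b" for a b
        using braid_braid_sym [OF p_nonzero t(2), of a b] xy by simp
      have c: "coord (braid_map t - smul x t) = (\<lambda>a b. braid p (coord t) a b - x * coord t a b)"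
        by (intro ext) (simp add: coord_diff coord_smul coord_braid_map t(1))
      have lin: "braid p (\<lambda>a b. braid p (coord t) a b - x * coord t a b) a b =
          braid p (braid p (coord t)) a b - x * braid p (coord t) a b" for a b
        using braid_linear [of p 1 "braid p (coord t)" "- x" "coord t" a b] by simp
      have "braid p (coord (braid_map t - smul x t)) a b =
          of_real y * coord (braid_map t - smul x t) a b" for a b
        unfolding c lin bb by (simp add: algebra_simps)
      then show ?thesis
        unfolding sym2_def braiding_eq using False xy(3)
        by (intro falg.span_base CollectI conjI exI [of _ y])
          (auto simp: braid_map_eigen falg.subspace_diff [OF subspace_tens] falg.subspace_scale [OF
              subspace_tens] t(1) braid_map_tens)
    qed (simp add: sym2_def falg.span_zero)
    have "braid_map t - smul (1 / p ^ 2) t \<in> sym2 q M"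
      by (rule eigen [of _ "q ^ 2", folded p_def])
        (use p_nonzero q_pos in \<open>simp_all add: field_simps power2_eq_square\<close>)
    moreover have "braid_map t - smul p t \<in> sym2 q M"
      by (rule eigen [of _ "inverse (q ^ 4)"])
        (use p_nonzero q_pos in \<open>simp_all add: of_real_inverse_p power2_eq_square del: of_real_power
            of_real_inverse\<close>)
    ultimately have "smul (1 / (p - 1 / p ^ 2)) ((braid_map t - smul (1 / p ^ 2) t) - (braid_map t -
        smul p t)) \<in> sym2 q M"
      unfolding sym2_def by (rule falg.span_scale [OF falg.span_diff])
    moreover have "(braid_map t - smul (1 / p ^ 2) t) - (braid_map t - smul p t) = smul (p - 1 / p ^ 2) t"
      by (simp add: falg.scale_left_diff_distrib)
    ultimately show "t \<in> sym2 q M" using p_neq by simp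
  qed
qed

lemma alt2_eq: "alt2 q M = {t \<in> tens 2. alt_eqs p (coord t)}"
proof
  show "alt2 q M \<subseteq> {t \<in> tens 2. alt_eqs p (coord t)}"
    unfolding alt2_def braiding_eq
  proof (rule falg.span_minimal [OF _ subspace_alt], safe)
    fix t and \<mu> :: real assume t: "t \<in> tens 2" "\<mu> < 0" "braid_map t = smul (of_real \<mu>) t"
    let ?c = "(of_real \<mu> - p) * (of_real \<mu> - 1 / p ^ 2)"
    have "\<mu> - q ^ 2 < 0" "\<mu> - inverse (q ^ 4) < 0" using t(2) q_pos
      by (simp_all add: less_trans [OF t(2)])
    then have "of_real (\<mu> - q ^ 2) \<noteq> (0 :: complex)" "of_real (\<mu> - inverse (q ^ 4)) \<noteq> (0 :: complex)"
      by (simp_all only: of_real_eq_0_iff)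
    then have c: "?c \<noteq> 0"
      unfolding of_real_diff of_real_inverse_p p_def [symmetric] by simp
    have e: "braid p (coord t) = (\<lambda>a b. of_real \<mu> * coord t a b)"
      using t braid_map_eigen [OF t(1)] by (intro ext) simp
    have ee: "braid p (braid p (coord t)) a b = of_real \<mu> * (of_real \<mu> * coord t a b)" for a b
      using braid_linear [of p "of_real \<mu>" "coord t" 0 "coord t" a b] by (simp add: e)
    have "(\<lambda>a b. braid p (braid p (coord t)) a b - (p + 1 / p ^ 2) * braid p (coord t) a b + coord t
        a b / p)
        = (\<lambda>a b. ?c * coord t a b)"
      unfolding ee unfolding e using p_nonzero by (intro ext) (simp add: field_simps power2_eq_square)
    then have "alt_eqs p (\<lambda>a b. ?c * coord t a b)"
      using alt_eqs_image [OF p_nonzero, of "coord t"] by simp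
    then show "alt_eqs p (coord t)" using c by (rule alt_eqs_cancel [rotated])
  qed
next
  show "{t \<in> tens 2. alt_eqs p (coord t)} \<subseteq> alt2 q M"
  proof safe
    fix t assume t: "t \<in> tens 2" "alt_eqs p (coord t)"
    have "braid_map t = smul (of_real (- inverse (q ^ 2))) t"
      unfolding braid_map_eigen [OF t(1)]
      using braid_alt [OF p_nonzero t(2)] by (simp add: p_def divide_inverse mult_ac)
    moreover have "- inverse (q ^ 2) < 0" using q_pos by simp
    ultimately show "t \<in> alt2 q M"
      unfolding alt2_def braiding_eq using t(1)
      by (cases "t = 0")
        (simp add: falg.span_zero, intro falg.span_base CollectI conjI exI [of _ "- inverse (q ^ 2)"], auto)
  qed
qed

end

lemma adjoint_module_u_plus:
  assumes "0 < q" "q < 1"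
  shows "adjoint_module q (u_plus q) id (\<lambda>i. 1)"
  using assms by unfold_locales (auto simp: u_plus_def)

text \<open>The dual module in the basis \<open>w\<^sub>-\<^sub>1, - w\<^sub>0, q\<^sup>2 w\<^sub>1\<close> is the adjoint module: \<open>flip\<close> and
  \<open>dual_scale\<close> describe this basis.\<close>

fun flip :: "idx \<Rightarrow> idx" where
  "flip I1 = Im1" | "flip I0 = I0" | "flip Im1 = I1"

fun dual_scale :: "real \<Rightarrow> idx \<Rightarrow> complex" where
  "dual_scale q I1 = 1" | "dual_scale q I0 = -1" | "dual_scale q Im1 = of_real (q ^ 2)"

lemma adjoint_module_u_minus:
  assumes "0 < q" "q < 1"
  shows "adjoint_module q (u_minus q) flip (dual_scale q)"
proof
  show "flip (flip i) = i" for i by (cases i) auto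
  show "dual_scale q i \<noteq> 0" for i using assms by (cases i) auto
  show "weight (u_minus q) (flip i) = idx_wt i" for i
    by (cases i) (auto simp: u_minus_def dual_module_def u_plus_def)
  show "mat (u_minus q) g (flip j) (flip i) = u_plus_mat q g j i * dual_scale q j / dual_scale q i"
    if "g \<in> {K1, K1inv, E1, F1}" for g i j
    using that assms
    by (cases i; cases j; auto simp: u_minus_def mat_dual_module UNIV_idx u_plus_def power_int_minus
        field_simps)
qed (use assms in auto)

section \<open>Normal words and their structure constants\<close>

text \<open>The basis of the exterior algebra: \<open>B0\<close> is the unit, \<open>B1 i\<close> and \<open>B2 i\<close> are the elements of
  weight \<open>i\<close> in degrees 1 and 2, and \<open>B3\<close> is the element of degree 3. It is represented by the
  words with strictly decreasing weights, called normal.\<close>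

datatype eb = B0 | B1 idx | B2 idx | B3

lemma UNIV_eb: "UNIV = {B0, B1 I1, B1 I0, B1 Im1, B2 I1, B2 I0, B2 Im1, B3}"
proof -
  have "n \<in> {B0, B1 I1, B1 I0, B1 Im1, B2 I1, B2 I0, B2 Im1, B3}" for n
  proof (cases n)
    case (B1 i)
    then show ?thesis by (cases i) simp_all
  next
    case (B2 i)
    then show ?thesis by (cases i) simp_all
  qed simp_all
  then show ?thesis by blast
qed

instance eb :: finite
  by standard (simp add: UNIV_eb)

fun deg :: "eb \<Rightarrow> nat" where
  "deg B0 = 0" | "deg (B1 i) = 1" | "deg (B2 i) = 2" | "deg B3 = 3"

fun nword :: "eb \<Rightarrow> idx list" where
  "nword B0 = []"
| "nword (B1 i) = [i]"
| "nword (B2 I1) = [I1, I0]"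
| "nword (B2 I0) = [I1, Im1]"
| "nword (B2 Im1) = [I0, Im1]"
| "nword B3 = [I1, I0, Im1]"

text \<open>The sum of two weights. The values of \<open>idx_add I1 I1\<close> and \<open>idx_add Im1 Im1\<close> are arbitrary:
  they are used only where the structure constant \<open>lc\<close> vanishes.\<close>

fun idx_add :: "idx \<Rightarrow> idx \<Rightarrow> idx" where
  "idx_add I0 j = j"
| "idx_add i I0 = i"
| "idx_add I1 Im1 = I0"
| "idx_add Im1 I1 = I0"
| "idx_add I1 I1 = I1"
| "idx_add Im1 Im1 = Im1"

text \<open>Multiplying the basis element \<open>n\<close> from the left by the letter \<open>i\<close> gives \<open>lc p k i n\<close> times
  the basis element \<open>shift i n\<close>; the value of \<open>shift\<close> is arbitrary where the product is \<open>0\<close>. Here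
  \<open>k\<close> is the coefficient in \<open>v\<^sub>0 v\<^sub>0 = k v\<^sub>1 v\<^sub>-\<^sub>1\<close>, which depends on the scaling of the basis vectors
  that the letters stand for.\<close>

fun shift :: "idx \<Rightarrow> eb \<Rightarrow> eb" where
  "shift i B0 = B1 i"
| "shift i (B1 j) = B2 (idx_add i j)"
| "shift i n = B3"

fun lc :: "complex \<Rightarrow> complex \<Rightarrow> idx \<Rightarrow> eb \<Rightarrow> complex" where
  "lc p k i B0 = 1"
| "lc p k I1 (B1 j) = (if j = I1 then 0 else 1)"
| "lc p k I0 (B1 I1) = - p"
| "lc p k I0 (B1 I0) = k"
| "lc p k I0 (B1 Im1) = 1"
| "lc p k Im1 (B1 I1) = - 1"
| "lc p k Im1 (B1 I0) = - p"
| "lc p k Im1 (B1 Im1) = 0"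
| "lc p k I1 (B2 j) = (if j = Im1 then 1 else 0)"
| "lc p k I0 (B2 j) = (if j = I0 then - p else 0)"
| "lc p k Im1 (B2 j) = (if j = I1 then p else 0)"
| "lc p k i B3 = 0"

text \<open>The word \<open>w\<close> reduces to \<open>coef p k w\<close> times the normal word of \<open>tgt w\<close>.\<close>

fun tgt :: "idx list \<Rightarrow> eb" where
  "tgt [] = B0"
| "tgt (i # w) = shift i (tgt w)"

fun coef :: "complex \<Rightarrow> complex \<Rightarrow> idx list \<Rightarrow> complex" where
  "coef p k [] = 1"
| "coef p k (i # w) = lc p k i (tgt w) * coef p k w"

text \<open>The quadratic relations suffice for this reduction. The relation \<open>P u c v\<close> stands for \<open>u =
  c v\<close> in an unspecified quotient. It is instantiated twice: by congruence modulo the ideal of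
  relations, and by linear equations between coefficients of antisymmetric tensors.\<close>

lemma word_reduction:
  assumes refl: "\<And>u. P u 1 u"
    and trans: "\<And>u v w a b. P u a v \<Longrightarrow> P v b w \<Longrightarrow> P u (a * b) w"
    and zero: "\<And>u v w. P u 0 v \<Longrightarrow> P u 0 w"
    and left: "\<And>u v c i. P u c v \<Longrightarrow> P (i # u) c (i # v)"
    and right: "\<And>u v c i. P u c v \<Longrightarrow> P (u @ [i]) c (v @ [i])"
    and rel: "\<And>i j. P [i, j] (lc p k i (B1 j)) (nword (shift i (B1 j)))"
  shows "P w (coef p k w) (nword (tgt w))"
proof -
  have r: "P [I1, I1] 0 v" "P [Im1, Im1] 0 v" "P [I0, I1] (- p) [I1, I0]" "P [I0, I0] k [I1, Im1]"
    "P [Im1, I1] (- 1) [I1, Im1]" "P [Im1, I0] (- p) [I0, Im1]" for v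
    using zero [of "[I1, I1]" "nword (B2 I1)" v] zero [of "[Im1, Im1]" "nword (B2 Im1)" v]
      rel [of I1 I1] rel [of Im1 Im1] rel [of I0 I1] rel [of I0 I0] rel [of Im1 I1] rel [of Im1 I0]
    by simp_all
  have t0: "P u 0 w" if "P u a v" "P v 0 v'" for u v v' w a
    by (rule zero, use trans [OF that] in simp)
  have l3: "P [i, j, l] c v" if "P [i, j] c [a, b]" "v = [a, b, l]" for i j l a b c v
    using right [OF that(1), of l] that(2) by simp
  have z: "P [I1, I1, l] 0 v" "P [Im1, Im1, l] 0 v" "P [l, I1, I1] 0 v" "P [l, Im1, Im1] 0 v" for l v
    by (rule zero, use right [OF r(1) [of "[]"], of l] in simp)
      (rule zero, use right [OF r(2) [of "[]"], of l] in simp,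
       rule zero, use left [OF r(1) [of "[]"], of l] in simp,
       rule zero, use left [OF r(2) [of "[]"], of l] in simp)
  have s2: "P (i # nword (B2 j)) (lc p k i (B2 j)) [I1, I0, Im1]" for i j
  proof (cases i; cases j; simp)
    show "P [I1, I1, I0] 0 [I1, I0, Im1]" "P [I1, I1, Im1] 0 [I1, I0, Im1]" by (fact z)+
    show "P [I1, I0, Im1] 1 [I1, I0, Im1]" by (fact refl)
    show "P [I0, I1, I0] 0 [I1, I0, Im1]"
      by (rule t0 [OF l3 [OF r(3) HOL.refl] t0 [OF left [OF r(4)] z(1)]])
    show "P [I0, I1, Im1] (- p) [I1, I0, Im1]" by (rule l3 [OF r(3) HOL.refl])
    show "P [I0, I0, Im1] 0 [I1, I0, Im1]" by (rule t0 [OF l3 [OF r(4) HOL.refl] z(4)])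
    show "P [Im1, I1, I0] p [I1, I0, Im1]"
      using trans [OF l3 [OF r(5) HOL.refl] left [OF r(6)]] by simp
    show "P [Im1, I1, Im1] 0 [I1, I0, Im1]" by (rule t0 [OF l3 [OF r(5) HOL.refl] z(4)])
    show "P [Im1, I0, Im1] 0 [I1, I0, Im1]" by (rule t0 [OF l3 [OF r(6) HOL.refl] z(4)])
  qed
  have s3: "P (i # nword B3) 0 [I1, I0, Im1]" for i
  proof (cases i; simp)
    show "P [I1, I1, I0, Im1] 0 [I1, I0, Im1]"
      by (rule zero, use right [OF z(1) [of I0 "[]"], of Im1] in simp)
    show "P [I0, I1, I0, Im1] 0 [I1, I0, Im1]"
      by (rule zero, use right [OF s2 [of I0 I1], of Im1] in simp)
    show "P [Im1, I1, I0, Im1] 0 [I1, I0, Im1]"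
      by (rule t0 [where a = p and v = "[I1, I0, Im1, Im1]"], use right [OF s2 [of Im1 I1], of Im1] in simp)
        (rule left [OF z(4)])
  qed
  have step: "P (i # nword n) (lc p k i n) (nword (shift i n))" for i n
    using refl rel s2 s3 by (cases n) auto
  show ?thesis
  proof (induction w)
    case Nil
    show ?case by (simp add: refl)
  next
    case (Cons i w)
    show ?case using trans [OF left [OF Cons, of i] step] by (simp add: mult.commute)
  qed
qed

lemma deg_shift: "n \<noteq> B3 \<Longrightarrow> deg (shift i n) = Suc (deg n)"
  by (cases n) auto

lemma coef_nonzero_length: "coef p k w \<noteq> 0 \<Longrightarrow> deg (tgt w) = length w"
  by (induction w) (auto simp: deg_shift split: if_splits dest: arg_cong [where f = deg],
    metis deg_shift lc.simps(12) mult_zero_left)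

lemma tgt_nword: "tgt (nword n) = n"
  by (cases n rule: nword.cases) auto

lemma coef_nword: "coef p k (nword n) = 1"
  by (cases n rule: nword.cases) auto

lemma length_nword: "length (nword n) = deg n"
  by (cases n rule: nword.cases) auto

text \<open>Reversal of words combined with the exchange of \<open>v\<^sub>1\<close> and \<open>v\<^sub>-\<^sub>1\<close> preserves the relations. The
  constants of right multiplication are therefore obtained from those of left multiplication.\<close>

fun eb_flip :: "eb \<Rightarrow> eb" where
  "eb_flip (B1 i) = B1 (flip i)"
| "eb_flip (B2 i) = B2 (flip i)"
| "eb_flip n = n"

lemma flip_flip [simp]: "flip (flip i) = i"
  by (cases i) auto

lemma eb_flip_flip [simp]: "eb_flip (eb_flip n) = n"
  by (cases n) auto

definition rc :: "complex \<Rightarrow> complex \<Rightarrow> eb \<Rightarrow> idx \<Rightarrow> complex" where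
  "rc p k n i = lc p k (flip i) (eb_flip n)"

definition shiftr :: "eb \<Rightarrow> idx \<Rightarrow> eb" where
  "shiftr n i = eb_flip (shift (flip i) (eb_flip n))"

lemma shift_shiftr: "shift j (shiftr n i) = shiftr (shift j n) i"
  by (cases n; cases i; cases j; simp add: shiftr_def)

text \<open>Left and right multiplications commute.\<close>

lemma lc_rc: "lc p k j (shiftr n i) * rc p k n i = rc p k (shift j n) i * lc p k j n"
proof (cases n)
  case (B1 l)
  then show ?thesis by (cases l; cases i; cases j; simp add: shiftr_def rc_def)
next
  case (B2 l)
  then show ?thesis by (cases l; cases i; cases j; simp add: shiftr_def rc_def)
qed (cases i; cases j; simp add: shiftr_def rc_def)+

lemma tgt_snoc: "tgt (w @ [i]) = shiftr (tgt w) i"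
  by (induction w) (simp_all add: shift_shiftr, simp add: shiftr_def)

lemma coef_snoc: "coef p k (w @ [i]) = rc p k (tgt w) i * coef p k w"
proof (induction w)
  case (Cons j w)
  then show ?case
    using lc_rc [of p k j "tgt w" i] by (simp add: tgt_snoc mult.assoc [symmetric])
qed (simp add: rc_def)

lemma tgt_reverse: "tgt (map flip (rev w)) = eb_flip (tgt w)"
  by (induction w) (simp_all add: tgt_snoc shiftr_def)

lemma coef_reverse: "coef p k (map flip (rev w)) = coef p k w"
  by (induction w) (simp_all add: coef_snoc tgt_reverse rc_def)

text \<open>The coefficient of the normal word of \<open>n\<close> in the reduction of \<open>w\<close>.\<close>

definition cf :: "complex \<Rightarrow> complex \<Rightarrow> eb \<Rightarrow> idx list \<Rightarrow> complex" where
  "cf p k n w = (if tgt w = n then coef p k w else 0)"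

lemma cf_Cons: "cf p k n (i # w) = (\<Sum>m\<in>UNIV. (if shift i m = n then lc p k i m else 0) * cf p k m w)"
proof -
  have "(\<Sum>m\<in>UNIV. (if shift i m = n then lc p k i m else 0) * cf p k m w) =
     (\<Sum>m\<in>UNIV. if tgt w = m then (if shift i m = n then lc p k i m else 0) * coef p k w else 0)"
    by (rule sum.cong) (auto simp: cf_def)
  then show ?thesis by (simp add: cf_def)
qed

lemma cf_snoc: "cf p k n (w @ [i]) = (\<Sum>m\<in>UNIV. (if shiftr m i = n then rc p k m i else 0) * cf p k m w)"
proof -
  have "(\<Sum>m\<in>UNIV. (if shiftr m i = n then rc p k m i else 0) * cf p k m w) =
     (\<Sum>m\<in>UNIV. if tgt w = m then (if shiftr m i = n then rc p k m i else 0) * coef p k w else 0)"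
    by (rule sum.cong) (auto simp: cf_def)
  then show ?thesis by (simp add: cf_def coef_snoc tgt_snoc)
qed

lemma cf_nword: "cf p k m (nword n) = (if m = n then 1 else 0)"
  by (auto simp: cf_def tgt_nword coef_nword)

lemma cf_length: "length w \<noteq> deg n \<Longrightarrow> cf p k n w = 0"
  using coef_nonzero_length [of p k w] by (cases "coef p k w = 0") (auto simp: cf_def)

section \<open>Exterior algebra and antisymmetric tensors\<close>

lemma ext_ideal_closed:
  shows "0 \<in> ext_ideal q M"
    and "x \<in> ext_ideal q M \<Longrightarrow> y \<in> ext_ideal q M \<Longrightarrow> x + y \<in> ext_ideal q M"
    and "x \<in> ext_ideal q M \<Longrightarrow> t * x \<in> ext_ideal q M"
    and "x \<in> ext_ideal q M \<Longrightarrow> x * t \<in> ext_ideal q M"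
proof -
  interpret ideal "ext_ideal q M" tensor_ring by (rule ideal_ext_ideal)
  show "0 \<in> ext_ideal q M" 
    using additive_subgroup.zero_closed [OF is_additive_subgroup] by (simp add: tensor_ring_def)
  show "x \<in> ext_ideal q M \<Longrightarrow> y \<in> ext_ideal q M \<Longrightarrow> x + y \<in> ext_ideal q M"
    using additive_subgroup.a_closed [OF is_additive_subgroup, of x y] by (simp add: tensor_ring_def)
  show "x \<in> ext_ideal q M \<Longrightarrow> t * x \<in> ext_ideal q M" "x \<in> ext_ideal q M \<Longrightarrow> x * t \<in> ext_ideal q M"
    using I_l_closed [of x t] I_r_closed [of x t] by (simp_all add: tensor_ring_def)
qed

lemma subspace_ext_ideal: "falg.subspace (ext_ideal q M)"
  by (rule falg.subspaceI) (auto simp: smul_def intro: ext_ideal_closed)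

lemma ext_cls_eq_iff: "ext_cls q M x = ext_cls q M y \<longleftrightarrow> x - y \<in> ext_ideal q M"
proof -
  have cls: "ext_cls q M t = {i + t | i. i \<in> ext_ideal q M}" for t
    by (auto simp: ext_cls_def a_r_coset_def' tensor_ring_def)
  note sub = falg.subspace_diff [OF subspace_ext_ideal] falg.subspace_add [OF subspace_ext_ideal]
  show ?thesis
  proof
    assume "ext_cls q M x = ext_cls q M y"
    moreover have "x \<in> ext_cls q M x" using ext_ideal_closed(1) by (force simp: cls)
    ultimately show "x - y \<in> ext_ideal q M" by (auto simp: cls)
  next
    assume *: "x - y \<in> ext_ideal q M"
    have "\<exists>j. i + x = j + y \<and> j \<in> ext_ideal q M" if "i \<in> ext_ideal q M" for i
      by (rule exI [of _ "i + (x - y)"]) (simp add: sub that *)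
    moreover have "\<exists>j. i + y = j + x \<and> j \<in> ext_ideal q M" if "i \<in> ext_ideal q M" for i
      by (rule exI [of _ "i - (x - y)"]) (simp add: sub that *)
    ultimately show "ext_cls q M x = ext_cls q M y" unfolding cls by blast
  qed
qed

lemma carrier_ext_alg: "carrier (ext_alg q M) = range (ext_cls q M)"
  by (auto simp: ext_alg_def FactRing_def A_RCOSETS_def' ext_cls_def tensor_ring_def)

lemma ext_cls_carrier [simp]: "ext_cls q M t \<in> carrier (ext_alg q M)"
  by (simp add: carrier_ext_alg)

lemma ext_cls_add: "ext_cls q M x \<oplus>\<^bsub>ext_alg q M\<^esub> ext_cls q M y = ext_cls q M (x + y)"
  using abelian_subgroup.a_rcos_sum [OF abelian_subgroupI3 [OF ideal.axioms(1) [OF ideal_ext_ideal]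
    ring.is_abelian_group [OF ring_tensor_ring]], of x y q M]
  by (simp add: ext_alg_def FactRing_def ext_cls_def tensor_ring_def)

lemma ext_cls_mult: "ext_cls q M x \<otimes>\<^bsub>ext_alg q M\<^esub> ext_cls q M y = ext_cls q M (x * y)"
  using ideal.rcoset_mult_add [OF ideal_ext_ideal, of x y q M]
  by (simp add: ext_alg_def FactRing_def ext_cls_def tensor_ring_def)

lemma ext_cls_zero: "\<zero>\<^bsub>ext_alg q M\<^esub> = ext_cls q M 0"
  by (auto simp: ext_alg_def FactRing_def ext_cls_def a_r_coset_def' tensor_ring_def)

lemma ext_cls_one: "\<one>\<^bsub>ext_alg q M\<^esub> = ext_cls q M 1"
  by (simp add: ext_alg_def FactRing_def ext_cls_def tensor_ring_def)

text \<open>A subspace of the free algebra is an ideal if it absorbs letters on both sides.\<close>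

lemma ideal_tensor_ringI:
  assumes "falg.subspace J" and "\<And>i t. t \<in> J \<Longrightarrow> wmon [i] * t \<in> J" and "\<And>i t. t \<in> J \<Longrightarrow> t * wmon [i] \<in> J"
  shows "ideal J tensor_ring"
proof (rule idealI [OF ring_tensor_ring])
  have inv: "\<ominus>\<^bsub>tensor_ring\<^esub> x = - x" for x
  proof (rule abelian_group.minus_equality [OF ring.is_abelian_group [OF ring_tensor_ring]])
  qed (simp_all add: tensor_ring_def)
  show "subgroup J (add_monoid tensor_ring)"
  proof (rule subgroup.intro)
    show "inv\<^bsub>add_monoid tensor_ring\<^esub> x \<in> J" if "x \<in> J" for x
      using falg.subspace_neg [OF assms(1) that] inv [of x] by (simp add: a_inv_def)
  qed (use falg.subspace_add [OF assms(1)] falg.subspace_0 [OF assms(1)] in \<open>auto simp: tensor_ring_def\<close>)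
  have left: "wmon w * t \<in> J" if "t \<in> J" for w t
  proof (induction w)
    case (Cons i w)
    then show ?case using assms(2) [of "wmon w * t" i] by (simp add: mult.assoc [symmetric] wmon_mult)
  qed (simp add: wmon_Nil that)
  have right: "t * wmon w \<in> J" if "t \<in> J" for w t
  proof (induction w rule: rev_induct)
    case (snoc i w)
    then show ?case using assms(3) [of "t * wmon w" i] by (simp add: mult.assoc wmon_mult)
  qed (simp add: wmon_Nil that)
  note sub = falg.subspace_add [OF assms(1)] falg.subspace_scale [OF assms(1)] falg.subspace_0 [OF assms(1)]
  have "x * t \<in> J" "t * x \<in> J" if "t \<in> J" for x t
    by (induction x rule: falg_induct) (simp_all add: distrib_left distrib_right sub smul_mult_left
        smul_mult_right left right that)
  then show "x \<otimes>\<^bsub>tensor_ring\<^esub> t \<in> J" "t \<otimes>\<^bsub>tensor_ring\<^esub> x \<in> J" if "t \<in> J" for x t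
    using that by (simp_all add: tensor_ring_def)
qed

context adjoint_module
begin

text \<open>The coefficient \<open>kap\<close> belongs to the antisymmetric tensors, and \<open>kap'\<close> to the relations of
  the exterior algebra. Only these two constants depend on the scaling of the basis, through
  \<open>\<delta>\<close>.\<close>

definition \<delta> :: complex where "\<delta> = d I0 * d I0 / (d I1 * d Im1)"

definition kap :: complex where "kap = (1 - p) * \<delta>"

definition kap' :: complex where "kap' = (1 / p - 1) / \<delta>"

abbreviation cls where "cls \<equiv> ext_cls q M"

text \<open>The coefficient of the normal word of \<open>n\<close> in the reduction of a tensor modulo the
  relations.\<close>

abbreviation lf :: "eb \<Rightarrow> idx falg \<Rightarrow> complex" where
  "lf n \<equiv> lfun (\<lambda>w. cf p kap' n (map \<sigma> w))"

lemma sym2_iff: "t \<in> sym2 q M \<longleftrightarrow> t \<in> tens 2 \<and> (\<forall>i. lf (B2 i) t = 0)"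
proof -
  have "(\<forall>i. lf (B2 i) t = 0) \<longleftrightarrow> sym_eqs p (coord t)" if "t \<in> tens 2"
  proof -
    have "lf (B2 i) t = (\<Sum>a\<in>UNIV. \<Sum>b\<in>UNIV. cf p kap' (B2 i) [a, b] * Poly_Mapping.lookup t [\<sigma> a, \<sigma>
        b])" for i
      unfolding lfun_tens2 [OF that]
      by (subst sum_sigma, rule sum.cong [OF refl], subst sum_sigma) (simp add: sigma_sigma)
    then have "lf (B2 I1) t = Poly_Mapping.lookup t [\<sigma> I1, \<sigma> I0] - p * Poly_Mapping.lookup t [\<sigma> I0, \<sigma> I1]"
      "lf (B2 Im1) t = Poly_Mapping.lookup t [\<sigma> I0, \<sigma> Im1] - p * Poly_Mapping.lookup t [\<sigma> Im1, \<sigma> I0]"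
      "lf (B2 I0) t = Poly_Mapping.lookup t [\<sigma> I1, \<sigma> Im1] - Poly_Mapping.lookup t [\<sigma> Im1, \<sigma> I1]
         + kap' * Poly_Mapping.lookup t [\<sigma> I0, \<sigma> I0]"
      by (simp_all add: idx_sum cf_def)
    moreover have "(\<forall>i. lf (B2 i) t = 0) \<longleftrightarrow> lf (B2 I1) t = 0 \<and> lf (B2 Im1) t = 0 \<and> lf (B2 I0) t = 0"
      by (metis idx.exhaust)
    moreover have "sym_eqs p (coord t) \<longleftrightarrow>
        Poly_Mapping.lookup t [\<sigma> I1, \<sigma> I0] = p * Poly_Mapping.lookup t [\<sigma> I0, \<sigma> I1] \<and>
        Poly_Mapping.lookup t [\<sigma> I0, \<sigma> Im1] = p * Poly_Mapping.lookup t [\<sigma> Im1, \<sigma> I0] \<and>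
        Poly_Mapping.lookup t [\<sigma> Im1, \<sigma> I1] = Poly_Mapping.lookup t [\<sigma> I1, \<sigma> Im1]
          + kap' * Poly_Mapping.lookup t [\<sigma> I0, \<sigma> I0]"
      using d_nonzero p_nonzero unfolding sym_eqs_def coord_def kap'_def \<delta>_def
      by (simp add: divide_simps) (simp add: algebra_simps)
    ultimately show ?thesis by (auto simp: algebra_simps)
  qed
  then show ?thesis by (auto simp: sym2_eq)
qed

lemma alt2_iff:
  "t \<in> alt2 q M \<longleftrightarrow> t \<in> tens 2 \<and> (\<forall>i j. Poly_Mapping.lookup t [\<sigma> i, \<sigma> j] =
     lc p kap i (B1 j) * Poly_Mapping.lookup t (map \<sigma> (nword (shift i (B1 j)))))"
proof -
  have "(\<forall>i j. P i j) \<longleftrightarrow> P I1 I1 \<and> P I1 I0 \<and> P I1 Im1 \<and> P I0 I1 \<and> P I0 I0 \<and> P I0 Im1 \<and>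
      P Im1 I1 \<and> P Im1 I0 \<and> P Im1 Im1" for P
    by (metis idx.exhaust)
  then have "(\<forall>i j. Poly_Mapping.lookup t [\<sigma> i, \<sigma> j] =
     lc p kap i (B1 j) * Poly_Mapping.lookup t (map \<sigma> (nword (shift i (B1 j))))) \<longleftrightarrow> alt_eqs p (coord t)"
    using d_nonzero unfolding alt_eqs_def coord_def kap_def \<delta>_def
    by (simp add: divide_simps) (auto simp: algebra_simps)
  then show ?thesis by (auto simp: alt2_eq)
qed

lemma subspace_lf_kernel: "falg.subspace {t. \<forall>n. lf n t = 0}"
  by (rule falg.subspaceI) (simp_all add: lfun_zero lfun_add lfun_smul)

text \<open>The ideal of relations is the common kernel of the functionals \<open>lf n\<close>: the kernel is an
  ideal since multiplying the argument by a letter turns \<open>lf n\<close> into a combination of such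
  functionals, and modulo the relations every tensor is a combination of normal words with
  coefficients \<open>lf n\<close>.\<close>

lemma ext_ideal_eq: "ext_ideal q M = {t. \<forall>n. lf n t = 0}"
proof
  have "ideal {t. \<forall>n. lf n t = 0} tensor_ring"
  proof (rule ideal_tensor_ringI [OF subspace_lf_kernel])
    fix i t assume t: "t \<in> {t. \<forall>n. lf n t = 0}"
    show "wmon [i] * t \<in> {t. \<forall>n. lf n t = 0}"
      using t by (simp add: lfun_mult_letter_left cf_Cons lfun_sum_fun lfun_scale_fun)
    show "t * wmon [i] \<in> {t. \<forall>n. lf n t = 0}"
      using t by (simp add: lfun_mult_letter_right cf_snoc lfun_sum_fun lfun_scale_fun)
  qed
  moreover have "sym2 q M \<subseteq> {t. \<forall>n. lf n t = 0}"
  proof safe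
    fix t n assume t: "t \<in> sym2 q M"
    show "lf n t = 0"
    proof (cases n)
      case (B2 i)
      then show ?thesis using t by (simp add: sym2_iff)
    qed (use t in \<open>simp_all add: sym2_iff lfun_def\<close>,
      (intro sum.neutral ballI disjI1 mult_zero_left cf_length; auto simp: tens_def)+)
  qed
  ultimately show "ext_ideal q M \<subseteq> {t. \<forall>n. lf n t = 0}"
    unfolding ext_ideal_def by (rule ring.genideal_minimal [OF ring_tensor_ring])
next
  let ?I = "ext_ideal q M"
  note sub = falg.subspace_add [OF subspace_ext_ideal] falg.subspace_scale [OF subspace_ext_ideal]
  have red: "wmon (map \<sigma> w) - smul (coef p kap' w) (wmon (map \<sigma> (nword (tgt w)))) \<in> ?I" for w
  proof (rule word_reduction [where P = "\<lambda>u c v. wmon (map \<sigma> u) - smul c (wmon (map \<sigma> v)) \<in> ?I"])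
    fix u v w :: "idx list" and a b :: complex and i j :: idx
    show "wmon (map \<sigma> u) - smul 1 (wmon (map \<sigma> u)) \<in> ?I" by (simp add: ext_ideal_closed)
    show "wmon (map \<sigma> u) - smul 0 (wmon (map \<sigma> w)) \<in> ?I" if "wmon (map \<sigma> u) - smul 0 (wmon (map \<sigma> v)) \<in> ?I"
      using that by simp
    show "wmon (map \<sigma> u) - smul (a * b) (wmon (map \<sigma> w)) \<in> ?I"
      if "wmon (map \<sigma> u) - smul a (wmon (map \<sigma> v)) \<in> ?I" "wmon (map \<sigma> v) - smul b (wmon (map \<sigma> w)) \<in> ?I"
      using sub(1) [OF that(1) sub(2) [OF that(2), of a]] by (simp add: falg.scale_right_diff_distrib)
    show "wmon (map \<sigma> (i # u)) - smul a (wmon (map \<sigma> (i # v))) \<in> ?I"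
      if "wmon (map \<sigma> u) - smul a (wmon (map \<sigma> v)) \<in> ?I"
      using ext_ideal_closed(3) [OF that, of "wmon [\<sigma> i]"] by
          (simp add: right_diff_distrib smul_mult_right wmon_mult)
    show "wmon (map \<sigma> (u @ [i])) - smul a (wmon (map \<sigma> (v @ [i]))) \<in> ?I"
      if "wmon (map \<sigma> u) - smul a (wmon (map \<sigma> v)) \<in> ?I"
      using ext_ideal_closed(4) [OF that, of "wmon [\<sigma> i]"] by
          (simp add: left_diff_distrib smul_mult_left wmon_mult)
    have "wmon [\<sigma> i, \<sigma> j] - smul (lc p kap' i (B1 j)) (wmon (map \<sigma> (nword (shift i (B1 j))))) \<in> sym2 q M"
      unfolding sym2_iff
    proof (intro conjI allI falg.subspace_diff [OF subspace_tens] falg.subspace_scale [OF subspace_tens])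
      show "wmon [\<sigma> i, \<sigma> j] \<in> tens 2" by (metis tens_wmon length_2_conv)
      show "wmon (map \<sigma> (nword (shift i (B1 j)))) \<in> tens 2"
        using tens_wmon [of "map \<sigma> (nword (shift i (B1 j)))"] by (simp add: length_nword)
      show "lf (B2 l) (wmon [\<sigma> i, \<sigma> j] - smul (lc p kap' i (B1 j)) (wmon (map \<sigma> (nword (shift i (B1
          j)))))) = 0" for l
        using cf_nword [of p kap' "B2 l" "shift i (B1 j)"]
        by (simp add: lfun_diff lfun_smul lfun_wmon sigma_sigma o_def) (simp add: cf_def)
    qed
    then show "wmon (map \<sigma> [i, j]) - smul (lc p kap' i (B1 j)) (wmon (map \<sigma> (nword (shift i (B1 j))))) \<in> ?I"
      using ring.genideal_self [OF ring_tensor_ring, of "sym2 q M"]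
      by (auto simp: ext_ideal_def tensor_ring_def)
  qed
  have "t - (\<Sum>n\<in>UNIV. smul (lf n t) (wmon (map \<sigma> (nword n)))) \<in> ?I" for t
  proof (induction t rule: falg_induct)
    case zero
    show ?case by (simp add: lfun_zero ext_ideal_closed)
  next
    case (add x y)
    then show ?case
      using sub(1) [OF add] by (simp add: lfun_add falg.scale_left_distrib sum.distrib algebra_simps)
  next
    case (mon c w)
    have "(\<Sum>n\<in>UNIV. smul (lf n (smul c (wmon w))) (wmon (map \<sigma> (nword n)))) =
       (\<Sum>n\<in>UNIV. if tgt (map \<sigma> w) = n then smul (c * coef p kap' (map \<sigma> w)) (wmon (map \<sigma> (nword n)))
           else 0)"
      by (rule sum.cong) (auto simp: lfun_smul lfun_wmon cf_def)
    then show ?case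
      using sub(2) [OF red [of "map \<sigma> w"], of c] by (simp add: sigma_sigma o_def
          falg.scale_right_diff_distrib)
  qed
  note reduced = this
  show "{t. \<forall>n. lf n t = 0} \<subseteq> ?I"
  proof safe
    fix t assume "\<forall>n. lf n t = 0"
    then show "t \<in> ?I" using reduced [of t] by simp
  qed
qed

end

lemma finite_words: "finite {w :: idx list. length w = k}"
  using finite_lists_length_eq [of "UNIV :: idx set" k] by simp

lemma sum_words_Suc:
  "(\<Sum>w | length w = Suc k. f w) = (\<Sum>i\<in>UNIV. \<Sum>w | length w = k. f (i # w))"
  for f :: "idx list \<Rightarrow> complex"
proof -
  let ?h = "\<lambda>(i, w). i # w :: idx list"
  have "{w :: idx list. length w = Suc k} = ?h ` (UNIV \<times> {w. length w = k})"
    by (auto simp: length_Suc_conv)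
  then have "(\<Sum>w | length w = Suc k. f w) = (\<Sum>x\<in>UNIV \<times> {w. length w = k}. f (?h x))"
    by (simp only:) (subst sum.reindex, auto simp: inj_on_def)
  then show ?thesis by (simp add: sum.cartesian_product case_prod_beta)
qed

lemma subspace_ext_tensors: "falg.subspace (ext_tensors q M k)"
  unfolding ext_tensors_def
  by (rule falg.subspaceI)
    (auto simp: falg.subspace_0 [OF subspace_tens] falg.subspace_add [OF subspace_tens]
      falg.subspace_scale [OF subspace_tens] intro: falg.span_zero falg.span_add falg.span_scale)

context adjoint_module
begin

text \<open>The antisymmetric tensor with coefficient 1 at the normal word of \<open>n\<close> and 0 at the other
  normal words, where a letter \<open>i\<close> stands for the basis vector \<open>\<sigma> i\<close> of the module.\<close>

definition alt :: "eb \<Rightarrow> idx falg" where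
  "alt n = (\<Sum>w | length w = deg n. smul (cf p kap n (map \<sigma> w)) (wmon w))"

lemma lookup_alt: "Poly_Mapping.lookup (alt n) w = cf p kap n (map \<sigma> w)"
proof -
  have "Poly_Mapping.lookup (alt n) w = (\<Sum>v | length v = deg n. if w = v then cf p kap n (map \<sigma> v) else 0)"
    by (auto simp: alt_def lookup_sum lookup_smul lookup_wmon intro!: sum.cong)
  then show ?thesis
    by (simp add: finite_words cf_length)
qed

lemma alt_tens: "alt n \<in> tens (deg n)"
  by (rule tensI) (simp add: lookup_alt cf_length)

lemma map_sigma_sigma [simp]: "map \<sigma> (map \<sigma> w) = w"
  by (simp add: sigma_sigma o_def)

lemma map_sigma_comp [simp]: "map (\<sigma> \<circ> \<sigma>) w = w"
  by (simp add: sigma_sigma o_def)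

lemma wmon_letter_tens: "wmon [i] \<in> tens 1"
  using tens_wmon [of "[i]"] by simp

lemma alt_Cons:
  assumes "n \<noteq> B0"
  shows "alt n = (\<Sum>i\<in>UNIV. \<Sum>m\<in>UNIV. smul (if shift i m = n then lc p kap i m else 0) (wmon [\<sigma> i] * alt m))"
proof (rule poly_mapping_eqI)
  fix w
  let ?t = "\<Sum>i\<in>UNIV. \<Sum>m\<in>UNIV. smul (if shift i m = n then lc p kap i m else 0) (wmon [\<sigma> i] * alt m)"
  show "Poly_Mapping.lookup (alt n) w = Poly_Mapping.lookup ?t w"
  proof (cases w)
    case Nil
    then show ?thesis using assms
      by (simp add: lookup_alt lookup_sum lookup_smul lookup_mult_split lookup_wmon cf_def)
  next
    case (Cons j' v)
    obtain j where j: "j' = \<sigma> j" using ex_sigma by metis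
    have "Poly_Mapping.lookup ?t w = (\<Sum>i\<in>UNIV. \<Sum>m\<in>UNIV.
        (if shift i m = n then lc p kap i m else 0) * ((if j = i then 1 else 0) * cf p kap m (map \<sigma> v)))"
      using lookup_mult_tens_left [OF wmon_letter_tens, of "[j']" _ _ v] unfolding Cons
      by (simp add: lookup_sum lookup_smul lookup_wmon lookup_alt j sigma_eq_iff mult.commute)
    also have "\<dots> = (\<Sum>i\<in>UNIV. if j = i then
        (\<Sum>m\<in>UNIV. (if shift i m = n then lc p kap i m else 0) * cf p kap m (map \<sigma> v)) else 0)"
      by (rule sum.cong) simp_all
    finally have "Poly_Mapping.lookup ?t w =
        (\<Sum>m\<in>UNIV. (if shift j m = n then lc p kap j m else 0) * cf p kap m (map \<sigma> v))"
      by simp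
    then show ?thesis
      by (simp add: Cons j lookup_alt cf_Cons sigma_sigma)
  qed
qed

lemma alt_snoc:
  assumes "n \<noteq> B0"
  shows "alt n = (\<Sum>i\<in>UNIV. \<Sum>m\<in>UNIV. smul (if shiftr m i = n then rc p kap m i else 0) (alt m * wmon [\<sigma> i]))"
proof (rule poly_mapping_eqI)
  fix w
  let ?t = "\<Sum>i\<in>UNIV. \<Sum>m\<in>UNIV. smul (if shiftr m i = n then rc p kap m i else 0) (alt m * wmon [\<sigma> i])"
  show "Poly_Mapping.lookup (alt n) w = Poly_Mapping.lookup ?t w"
  proof (cases w rule: rev_cases)
    case Nil
    then show ?thesis using assms
      by (simp add: lookup_alt lookup_sum lookup_smul lookup_mult_split lookup_wmon cf_def)
  next
    case (snoc v j')
    obtain j where j: "j' = \<sigma> j" using ex_sigma by metis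
    have "Poly_Mapping.lookup ?t w = (\<Sum>i\<in>UNIV. \<Sum>m\<in>UNIV.
        (if shiftr m i = n then rc p kap m i else 0) * ((if j = i then 1 else 0) * cf p kap m (map \<sigma> v)))"
      using lookup_mult_tens_right [OF wmon_letter_tens, of "[j']" _ _ v] unfolding snoc
      by (simp add: lookup_sum lookup_smul lookup_wmon lookup_alt j sigma_eq_iff mult.commute)
    also have "\<dots> = (\<Sum>i\<in>UNIV. if j = i then
        (\<Sum>m\<in>UNIV. (if shiftr m i = n then rc p kap m i else 0) * cf p kap m (map \<sigma> v)) else 0)"
      by (rule sum.cong) simp_all
    finally have "Poly_Mapping.lookup ?t w =
        (\<Sum>m\<in>UNIV. (if shiftr m j = n then rc p kap m j else 0) * cf p kap m (map \<sigma> v))"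
      by simp
    then show ?thesis
      by (simp add: snoc j lookup_alt cf_snoc sigma_sigma)
  qed
qed

lemma alt_B2_alt2: "alt (B2 l) \<in> alt2 q M"
  unfolding alt2_iff
proof (intro conjI allI)
  show "alt (B2 l) \<in> tens 2" using alt_tens [of "B2 l"] by simp
  fix i j
  show "Poly_Mapping.lookup (alt (B2 l)) [\<sigma> i, \<sigma> j] =
      lc p kap i (B1 j) * Poly_Mapping.lookup (alt (B2 l)) (map \<sigma> (nword (shift i (B1 j))))"
    using cf_nword [of p kap "B2 l" "shift i (B1 j)"]
    by (simp only: lookup_alt map_sigma_sigma) (simp add: cf_def sigma_sigma)
qed

lemma alt_ext_tensors: "alt n \<in> ext_tensors q M (deg n)"
  unfolding ext_tensors_def
proof (intro CollectI conjI allI impI)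
  show "alt n \<in> tens (deg n)" by (rule alt_tens)
  fix i assume i: "i + 2 \<le> deg n"
  define S where "S j k = {a * x * b | a x b. a \<in> tens j \<and> x \<in> alt2 q M \<and> b \<in> tens k}" for j k
  have one: "1 \<in> (tens 0 :: idx falg set)" using tens_wmon [of "[]"] by (simp add: wmon_Nil)
  have S: "a * x * b \<in> S j k" if "a \<in> tens j" "x \<in> alt2 q M" "b \<in> tens k" for a x b j k
    using that by (auto simp: S_def)
  have X2: "alt (B2 l) \<in> S 0 0" for l
    using S [OF one alt_B2_alt2 one] by simp
  have X2w: "alt (B2 l) * wmon [j] \<in> S 0 1" for l j
    using S [OF one alt_B2_alt2 wmon_letter_tens] by simp
  have wX2: "wmon [j] * alt (B2 l) \<in> S 1 0" for l j
    using S [OF wmon_letter_tens alt_B2_alt2 one] by simp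
  consider l where "n = B2 l" "i = 0" | "n = B3" "i = 0" | "n = B3" "i = 1"
    using i by (cases n) fastforce+
  then have "alt n \<in> falg.span (S i (deg n - 2 - i))"
  proof cases
    case 1
    then show ?thesis using X2 by (simp add: falg.span_base)
  next
    case 2
    have "smul (if shiftr m j = B3 then rc p kap m j else 0) (alt m * wmon [\<sigma> j])
        \<in> falg.span (S 0 1)" for m j
    proof (cases m)
      case (B2 l)
      then show ?thesis using X2w by (intro falg.span_scale [OF falg.span_base]) simp
    qed (simp_all add: rc_def shiftr_def falg.span_zero)
    then have "alt B3 \<in> falg.span (S 0 1)"
      by (subst alt_snoc) (simp, intro falg.span_sum)
    then show ?thesis by (simp add: 2)
  next
    case 3
    have "smul (if shift j m = B3 then lc p kap j m else 0) (wmon [\<sigma> j] * alt m)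
        \<in> falg.span (S 1 0)" for m j
    proof (cases m)
      case (B2 l)
      then show ?thesis using wX2 by (intro falg.span_scale [OF falg.span_base]) simp
    qed (simp_all add: falg.span_zero)
    then have "alt B3 \<in> falg.span (S 1 0)"
      by (subst alt_Cons) (simp, intro falg.span_sum)
    then show ?thesis by (simp add: 3)
  qed
  then show "alt n \<in> falg.span {a * x * b | a x b. a \<in> tens i \<and> x \<in> alt2 q M \<and> b \<in> tens (deg n - 2 - i)}"
    by (simp add: S_def)
qed

text \<open>Conversely the coefficients of an antisymmetric tensor satisfy the same kind of relations
  as words in the exterior algebra, and so they are determined by the coefficients of the normal
  words.\<close>

lemma ext_tensors_expand:
  assumes "t \<in> ext_tensors q M k"
  shows "t = (\<Sum>n\<in>UNIV. smul (Poly_Mapping.lookup t (map \<sigma> (nword n))) (alt n))"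
proof -
  have t: "t \<in> tens k" using assms by (simp add: ext_tensors_def)
  let ?P = "\<lambda>a c b. \<forall>u v. Poly_Mapping.lookup t (u @ map \<sigma> a @ v) =
      c * Poly_Mapping.lookup t (u @ map \<sigma> b @ v)"
  have red: "?P w (coef p kap w) (nword (tgt w))" for w
  proof (rule word_reduction [where P = ?P])
    fix a b :: "idx list" and c :: complex and i j
    show "?P (i # a) c (i # b)" if P: "?P a c b"
    proof (intro allI)
      fix u v
      show "Poly_Mapping.lookup t (u @ map \<sigma> (i # a) @ v) =
          c * Poly_Mapping.lookup t (u @ map \<sigma> (i # b) @ v)"
        using P [rule_format, of "u @ [\<sigma> i]" v] by simp
    qed
    show "?P (a @ [i]) c (b @ [i])" if P: "?P a c b"
    proof (intro allI)
      fix u v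
      show "Poly_Mapping.lookup t (u @ map \<sigma> (a @ [i]) @ v) =
          c * Poly_Mapping.lookup t (u @ map \<sigma> (b @ [i]) @ v)"
        using P [rule_format, of u "\<sigma> i # v"] by simp
    qed
    show "?P [i, j] (lc p kap i (B1 j)) (nword (shift i (B1 j)))"
    proof (intro allI)
      fix u v
      let ?w = "map \<sigma> (nword (shift i (B1 j)))"
      have len: "length ?w = 2" by (simp add: length_nword)
      show "Poly_Mapping.lookup t (u @ map \<sigma> [i, j] @ v) =
          lc p kap i (B1 j) * Poly_Mapping.lookup t (u @ ?w @ v)"
      proof (cases "length u + 2 + length v = k")
        case True
        let ?H = "{s. Poly_Mapping.lookup s (u @ map \<sigma> [i, j] @ v) =
            lc p kap i (B1 j) * Poly_Mapping.lookup s (u @ ?w @ v)}"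
        have "t \<in> falg.span {a * x * b | a x b. a \<in> tens (length u) \<and> x \<in> alt2 q M \<and> b
            \<in> tens (k - 2 - length u)}"
          using assms True unfolding ext_tensors_def by auto
        moreover have "falg.span {a * x * b | a x b. a \<in> tens (length u) \<and> x \<in> alt2 q M \<and> b
            \<in> tens (k - 2 - length u)} \<subseteq> ?H"
        proof (rule falg.span_minimal)
          show "falg.subspace ?H"
            by (rule falg.subspaceI) (auto simp: lookup_add lookup_smul distrib_left)
          show "{a * x * b | a x b. a \<in> tens (length u) \<and> x \<in> alt2 q M \<and> b \<in> tens (k - 2 - length u)} \<subseteq> ?H"
          proof safe
            fix a x b :: "idx falg" assume a: "a \<in> tens (length u)" and x: "x \<in> alt2 q M" and b: "b
                \<in> tens (k - 2 - length u)"
            have x2: "x \<in> tens 2" using x by (simp add: alt2_iff)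
            have "Poly_Mapping.lookup (a * x * b) (u @ w @ v) =
                Poly_Mapping.lookup a u * (Poly_Mapping.lookup x w * Poly_Mapping.lookup b v)"
              if "length w = 2" for w
              using that by (simp add: mult.assoc lookup_mult_tens_left [OF a] lookup_mult_tens_left
                  [OF x2])
            note l = this
            have l2: "Poly_Mapping.lookup (a * x * b) (u @ map \<sigma> [i, j] @ v) =
                Poly_Mapping.lookup a u * (Poly_Mapping.lookup x (map \<sigma> [i, j]) * Poly_Mapping.lookup b v)"
              by (rule l) simp
            have "Poly_Mapping.lookup x (map \<sigma> [i, j]) = lc p kap i (B1 j) * Poly_Mapping.lookup x ?w"
              using x by (simp add: alt2_iff)
            then show "Poly_Mapping.lookup (a * x * b) (u @ map \<sigma> [i, j] @ v) =
                lc p kap i (B1 j) * Poly_Mapping.lookup (a * x * b) (u @ ?w @ v)"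
              by (simp only: l [OF len] l2) simp
          qed
        qed
        ultimately show ?thesis by blast
      next
        case False
        then show ?thesis using len by (simp add: tens_lookup [OF t])
      qed
    qed
  qed simp_all
  show ?thesis
  proof (rule poly_mapping_eqI)
    fix w
    have "Poly_Mapping.lookup (\<Sum>n\<in>UNIV. smul (Poly_Mapping.lookup t (map \<sigma> (nword n))) (alt n)) w =
       (\<Sum>n\<in>UNIV. if tgt (map \<sigma> w) = n then Poly_Mapping.lookup t (map \<sigma> (nword n)) * coef p kap (map
           \<sigma> w) else 0)"
      unfolding lookup_sum lookup_smul lookup_alt cf_def by (rule sum.cong) simp_all
    then show "Poly_Mapping.lookup t w =
        Poly_Mapping.lookup (\<Sum>n\<in>UNIV. smul (Poly_Mapping.lookup t (map \<sigma> (nword n))) (alt n)) w"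
      using red [of "map \<sigma> w", rule_format, of "[]" "[]"] by simp
  qed
qed

definition alt_norm :: "eb \<Rightarrow> complex" where "alt_norm n = lf n (alt n)"

lemma lf_alt: "lf m (alt n) = (if m = n then alt_norm n else 0)"
  by (auto simp: alt_norm_def lfun_def lookup_alt cf_def intro!: sum.neutral)

lemma kap_mult: "kap * kap' = (1 - p) * (1 / p - 1)"
  using d_nonzero by (simp add: kap_def kap'_def \<delta>_def)

text \<open>The pairing between the functionals \<open>lf n\<close> and the antisymmetric tensors is diagonal, with
  entries that are polynomials in \<open>q\<close> and \<open>1 / q\<close> with positive coefficients. This is where the
  projection of antisymmetric tensors to the exterior algebra is seen to be bijective.\<close>

lemma alt_norm_nonzero: "alt_norm n \<noteq> 0"
proof -
  have alt_norm: "alt_norm n = (\<Sum>w | length w = deg n. cf p kap n w * cf p kap' n w)" for n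
  proof -
    have "alt_norm n = (\<Sum>w | length w = deg n. cf p kap' n (map \<sigma> w) * Poly_Mapping.lookup (alt n) w)"
      unfolding alt_norm_def using alt_tens [of n] by (intro lfun_superset finite_words)
          (auto simp: tens_def)
    also have "\<dots> = (\<Sum>w | length w = deg n. cf p kap n w * cf p kap' n w)"
      by (rule sum.reindex_bij_witness [of _ "map \<sigma>" "map \<sigma>"]) (auto simp: lookup_alt mult.commute)
    finally show ?thesis .
  qed
  have k: "kap * (kap' * x) = (1 - p) * (1 / p - 1) * x" for x
    by (simp add: kap_mult mult.assoc [symmetric])
  have q2: "q ^ 2 > 0" using q_pos by simp
  have "alt_norm n \<in> {1, 1 + p ^ 2, p + 1 / p, 1 + p + 2 * p ^ 2 + p ^ 3 + p ^ 4}"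
  proof (cases n)
    case (B2 i)
    then show ?thesis
      by (cases i)
       (simp_all add: alt_norm numeral_2_eq_2 sum_words_Suc idx_sum cf_def kap_mult power2_eq_square,
        simp_all add: field_simps p_nonzero)
  next
    case B3
    then show ?thesis
      by (simp add: alt_norm numeral_3_eq_3 sum_words_Suc idx_sum cf_def k kap_mult mult_ac)
        (simp add: field_simps p_nonzero power2_eq_square power3_eq_cube power4_eq_xxxx)
  next
    case (B1 i)
    then show ?thesis by (cases i; simp add: alt_norm sum_words_Suc idx_sum cf_def)
  qed (simp add: alt_norm cf_def)
  moreover have "1 + p ^ 2 = of_real (1 + q ^ 4)" "p + 1 / p = of_real (q ^ 2 + 1 / q ^ 2)"
    "1 + p + 2 * p ^ 2 + p ^ 3 + p ^ 4 = of_real (1 + q ^ 2 + 2 * q ^ 4 + q ^ 6 + q ^ 8)"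
    by (simp_all add: p_def flip: power_mult)
  moreover have "1 + q ^ 4 \<noteq> 0" "q ^ 2 + 1 / q ^ 2 \<noteq> 0" "1 + q ^ 2 + 2 * q ^ 4 + q ^ 6 + q ^ 8 \<noteq> 0"
    using q_pos by (intro less_imp_neq [symmetric] add_pos_pos; simp)+
  ultimately show ?thesis by (auto simp del: of_real_add of_real_mult of_real_power of_real_divide)
qed

text \<open>The projection of the free algebra onto the antisymmetric tensors along the ideal of
  relations.\<close>

definition alt_rep :: "idx falg \<Rightarrow> idx falg" where
  "alt_rep t = (\<Sum>n\<in>UNIV. smul (lf n t / alt_norm n) (alt n))"

lemma lf_alt_rep: "lf m (alt_rep t) = lf m t"
proof -
  have "lf m (alt_rep t) = (\<Sum>n\<in>UNIV. if m = n then lf n t / alt_norm n * alt_norm n else 0)"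
    unfolding alt_rep_def lfun_sum lfun_smul lf_alt by (rule sum.cong) auto
  then show ?thesis by (simp add: alt_norm_nonzero)
qed

lemma alt_rep_linear: "alt_rep (x + y) = alt_rep x + alt_rep y" "alt_rep (smul c x) = smul c (alt_rep x)"
  by (simp_all add: alt_rep_def lfun_add lfun_smul add_divide_distrib falg.scale_left_distrib sum.distrib
    falg.scale_sum_right)

lemma cls_eq_iff: "cls x = cls y \<longleftrightarrow> alt_rep x = alt_rep y"
proof
  assume "cls x = cls y"
  then have "lf n x = lf n y" for n by (simp add: ext_cls_eq_iff ext_ideal_eq lfun_diff)
  then show "alt_rep x = alt_rep y" by (simp add: alt_rep_def)
next
  assume "alt_rep x = alt_rep y"
  then have "lf n x = lf n y" for n using lf_alt_rep by metis
  then show "cls x = cls y" by (simp add: ext_cls_eq_iff ext_ideal_eq lfun_diff)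
qed

lemma alt_rep_alt: "alt_rep (alt n) = alt n"
proof -
  have "alt_rep (alt n) = (\<Sum>m\<in>UNIV. if m = n then alt n else 0)"
    unfolding alt_rep_def by (rule sum.cong) (auto simp: lf_alt alt_norm_nonzero)
  then show ?thesis by simp
qed

lemma alt_rep_sum: "alt_rep (\<Sum>a\<in>A. x a) = (\<Sum>a\<in>A. alt_rep (x a))"
  using alt_rep_linear(2) [of 0 0] by (induction A rule: infinite_finite_induct)
      (simp_all add: alt_rep_linear)

lemma alt_rep_alt_rep: "alt_rep (alt_rep t) = alt_rep t"
  unfolding alt_rep_def [of t] by (simp add: alt_rep_sum alt_rep_linear alt_rep_alt)

lemma cls_alt_rep: "cls (alt_rep t) = cls t"
  by (simp add: cls_eq_iff alt_rep_alt_rep)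

lemma alt_rep_ext_tensors:
  assumes "t \<in> tens k"
  shows "alt_rep t \<in> ext_tensors q M k"
proof -
  have "lf n t = 0" if "deg n \<noteq> k" for n
    using lfun_cong [OF assms, of _ "\<lambda>w. 0"] that by (simp add: cf_length lfun_zero_fun)
  then have "smul (lf n t / alt_norm n) (alt n) \<in> ext_tensors q M k" for n
    using alt_ext_tensors [of n] falg.subspace_0 [OF subspace_ext_tensors] falg.subspace_scale [OF
        subspace_ext_tensors]
    by (cases "deg n = k") auto
  then show ?thesis unfolding alt_rep_def by (intro falg.subspace_sum [OF subspace_ext_tensors])
qed

lemma alt_rep_eq: "t \<in> ext_tensors q M k \<Longrightarrow> alt_rep t = t"
  by (subst (1 2) ext_tensors_expand) (simp_all add: alt_rep_sum alt_rep_linear alt_rep_alt)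

lemma pi_inv_cls:
  assumes "t \<in> tens k"
  shows "pi_inv q M k (cls t) = alt_rep t"
  unfolding pi_inv_def
proof (rule the_inv_into_f_eq)
  show "inj_on cls (ext_tensors q M k)"
    by (rule inj_onI) (metis cls_eq_iff alt_rep_eq)
qed (simp_all add: cls_alt_rep alt_rep_ext_tensors assms)

end

section \<open>Contractions and the operators on the exterior algebra\<close>

lemma tensor_pair_lfun_right: "tensor_pair s t = lfun (\<lambda>w. Poly_Mapping.lookup s (rev w)) t"
  by (simp add: tensor_pair_def lfun_def)

lemma tensor_pair_lfun_left: "tensor_pair s t = lfun (\<lambda>u. Poly_Mapping.lookup t (rev u)) s"
proof -
  let ?S = "Poly_Mapping.keys t \<union> rev ` Poly_Mapping.keys s"
  have "tensor_pair s t = (\<Sum>w\<in>?S. Poly_Mapping.lookup s (rev w) * Poly_Mapping.lookup t w)"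
    by (rule tensor_pair_superset) auto
  also have "\<dots> = (\<Sum>u\<in>rev ` ?S. Poly_Mapping.lookup t (rev u) * Poly_Mapping.lookup s u)"
    by (rule sum.reindex_bij_witness [of _ rev rev]) auto
  also have "\<dots> = lfun (\<lambda>u. Poly_Mapping.lookup t (rev u)) s"
    by (rule lfun_superset [symmetric]) (force simp: image_Un image_image)+
  finally show ?thesis .
qed

text \<open>Contraction of the first tensor factor with \<open>w\<^sub>i\<close>, scaled by the quotient of the factors of
  the pairing in the two degrees.\<close>

definition contract :: "(nat \<Rightarrow> complex) \<Rightarrow> idx \<Rightarrow> idx falg \<Rightarrow> idx falg" where
  "contract lam i = linext (\<lambda>w. case w of [] \<Rightarrow> 0 | j # v \<Rightarrow>
     if j = i then smul (lam (Suc (length v)) / lam (length v)) (wmon v) else 0)"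

lemma lookup_contract:
  "Poly_Mapping.lookup (contract lam i t) w = lam (Suc (length w)) / lam (length w) *
      Poly_Mapping.lookup t (i # w)"
proof (induction t rule: falg_induct)
  case (mon c u)
  show ?case
    by (cases u) (auto simp: contract_def linext_smul linext_wmon lookup_smul lookup_wmon)
qed (simp_all add: contract_def linext_add linext_zero lookup_add algebra_simps add_divide_distrib)

lemma contract_linear:
  "contract lam i (x + y) = contract lam i x + contract lam i y"
  "contract lam i (smul c x) = smul c (contract lam i x)"
  by (simp_all add: contract_def linext_add linext_smul)

lemma contract_sum: "contract lam i (\<Sum>a\<in>A. x a) = (\<Sum>a\<in>A. contract lam i (x a))"
  by (simp add: contract_def linext_sum)

lemma contract_tens: "t \<in> tens (Suc k) \<Longrightarrow> contract lam i t \<in> tens k"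
  by (rule tensI) (simp add: lookup_contract tens_lookup)

lemma tensor_pair_contract:
  assumes "s \<in> tens k" and "lam k \<noteq> 0"
  shows "lam k * tensor_pair s (contract lam i y) = lam (Suc k) * tensor_pair (s * wmon [i]) y"
proof -
  have "tensor_pair s (contract lam i y) =
      lam (Suc k) / lam k * lfun (\<lambda>u. Poly_Mapping.lookup y (i # rev u)) s"
    unfolding tensor_pair_lfun_left lfun_scale_fun [symmetric] by (rule lfun_cong [OF assms(1)])
        (simp add: lookup_contract)
  then show ?thesis
    using assms(2) by (simp add: tensor_pair_lfun_left lfun_mult_letter_right)
qed

lemma ext_End_cls:
  assumes "G \<in> ext_End q M"
  shows "G (ext_cls q M (x + y)) = G (ext_cls q M x) \<oplus>\<^bsub>ext_alg q M\<^esub> G (ext_cls q M y)"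
    and "G (ext_cls q M (smul c x)) = ext_scale q M c (G (ext_cls q M x))"
  using assms by (simp_all add: ext_End_def ext_cls_add [symmetric] ext_scale_cls [symmetric])

lemma ext_End_eqI:
  assumes G: "G \<in> ext_End q M" and H: "H \<in> ext_End q M"
    and words: "\<And>w. G (ext_cls q M (wmon w)) = H (ext_cls q M (wmon w))"
  shows "G = H"
proof -
  have "G (ext_cls q M t) = H (ext_cls q M t)" for t
  proof (induction t rule: falg_induct)
    case zero
    show ?case
      using ext_End_cls(2) [OF G, of 0 "wmon []"] ext_End_cls(2) [OF H, of 0 "wmon []"] words [of "[]"]
      by simp
  qed (simp_all add: ext_End_cls [OF G] ext_End_cls [OF H] words)
  then show ?thesis
    using G H by (intro extensionalityI [of G "carrier (ext_alg q M)" H])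
        (auto simp: ext_End_def carrier_ext_alg)
qed

text \<open>The module and its dual side by side, with the scalars of the pairing in each degree.\<close>

locale dual_pair =
  fixes q :: real and lam :: "nat \<Rightarrow> complex"
  assumes q01: "0 < q" "q < 1" and lam: "lam k \<noteq> 0"
begin

sublocale pl: adjoint_module q "u_plus q" id "\<lambda>i. 1"
  by (rule adjoint_module_u_plus [OF q01])

sublocale mi: adjoint_module q "u_minus q" flip "dual_scale q"
  by (rule adjoint_module_u_minus [OF q01])

lemma kap_plus: "pl.kap = 1 - pl.p"
  by (simp add: pl.kap_def pl.\<delta>_def)

lemma kap_minus: "mi.kap' = 1 - pl.p"
proof -
  have "complex_of_real (q ^ 2) = pl.p" by (simp add: pl.p_def)
  then show ?thesis
    using pl.p_nonzero by (simp add: mi.kap'_def mi.\<delta>_def divide_simps del: of_real_power)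
qed

lemma cf_rev: "cf p k n (rev u) = cf p k (eb_flip n) (map flip u)"
proof -
  have "rev u = map flip (rev (map flip u))" by (simp add: rev_map o_def)
  then have "tgt (rev u) = eb_flip (tgt (map flip u))" "coef p k (rev u) = coef p k (map flip u)"
    by (metis tgt_reverse, metis coef_reverse)
  moreover have "eb_flip m = n \<longleftrightarrow> m = eb_flip n" for m by (metis eb_flip_flip)
  ultimately show ?thesis by (simp add: cf_def)
qed

text \<open>The functionals that cut out the relations of the dual exterior algebra are given by the
  antisymmetric tensors of the module: the constant \<open>kap'\<close> of the dual equals \<open>kap\<close>. So the
  pairing with an antisymmetric tensor depends only on the class of the other argument.\<close>

lemma tensor_pair_alt: "tensor_pair s (pl.alt n) = mi.lf (eb_flip n) s"
  unfolding tensor_pair_lfun_left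
  by (simp add: pl.lookup_alt cf_rev kap_plus kap_minus)

lemma tensor_pair_alt_rep: "tensor_pair (mi.alt_rep s) (pl.alt_rep t) = tensor_pair s (pl.alt_rep t)"
proof -
  have "tensor_pair s (pl.alt_rep t) = (\<Sum>n\<in>UNIV. pl.lf n t / pl.alt_norm n * tensor_pair s (pl.alt
      n))" for s
    by (simp add: tensor_pair_lfun_right pl.alt_rep_def lfun_sum lfun_smul)
  then show ?thesis by (simp add: tensor_pair_alt mi.lf_alt_rep)
qed

lemma ext_pair_cls:
  assumes "s \<in> tens k" and "t \<in> tens k"
  shows "ext_pair q lam k (mi.cls s) (pl.cls t) = lam k * tensor_pair s (pl.alt_rep t)"
  using assms by (simp add: ext_pair_def mi.pi_inv_cls pl.pi_inv_cls tensor_pair_alt_rep)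

text \<open>The matrix of the contraction with \<open>w\<^sub>i\<close> in the basis of antisymmetric tensors.\<close>

definition gcoef :: "idx \<Rightarrow> eb \<Rightarrow> eb \<Rightarrow> complex" where
  "gcoef i m n = (if shift i m = n then lam (Suc (deg m)) / lam (deg m) * lc pl.p pl.kap i m else 0)"

lemma contract_alt: "contract lam i (pl.alt n) = (\<Sum>m\<in>UNIV. smul (gcoef i m n) (pl.alt m))"
proof (rule poly_mapping_eqI)
  fix w
  have "(if shift i m = n then lc pl.p pl.kap i m else 0) * cf pl.p pl.kap m w * (lam (Suc (length
      w)) / lam (length w))
      = gcoef i m n * cf pl.p pl.kap m w" for m
    by (cases "length w = deg m") (simp_all add: gcoef_def cf_length)
  then show "Poly_Mapping.lookup (contract lam i (pl.alt n)) w =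
      Poly_Mapping.lookup (\<Sum>m\<in>UNIV. smul (gcoef i m n) (pl.alt m)) w"
    by (simp add: lookup_contract pl.lookup_alt cf_Cons lookup_sum lookup_smul sum_distrib_left
        mult.commute)
qed

lemma alt_rep_contract: "pl.alt_rep (contract lam i (pl.alt_rep t)) = contract lam i (pl.alt_rep t)"
  by (simp add: pl.alt_rep_def [of t] contract_sum contract_linear contract_alt pl.alt_rep_sum
      pl.alt_rep_linear pl.alt_rep_alt)

text \<open>The operator \<open>\<gamma>\<^sub>-(w\<^sub>i)\<close>: contraction of the antisymmetric representative of a class.\<close>

definition gam :: "idx \<Rightarrow> idx falg set \<Rightarrow> idx falg set" where
  "gam i = (\<lambda>x\<in>carrier (ext_alg q (u_plus q)). pl.cls (contract lam i (pl.alt_rep (SOME t. pl.cls t = x))))"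

lemma gam_cls: "gam i (pl.cls t) = pl.cls (contract lam i (pl.alt_rep t))"
proof -
  have "pl.cls (SOME s. pl.cls s = pl.cls t) = pl.cls t" by (rule someI [where P = "\<lambda>s. pl.cls s =
      pl.cls t"]) simp
  then have "pl.alt_rep (SOME s. pl.cls s = pl.cls t) = pl.alt_rep t" by (simp add: pl.cls_eq_iff)
  then show ?thesis by (simp add: gam_def)
qed

lemma gam_End: "gam i \<in> ext_End q (u_plus q)"
proof -
  have "gam i \<in> extensional (carrier (ext_alg q (u_plus q)))" by (simp add: gam_def)
  then show ?thesis
    by (auto simp: ext_End_def carrier_ext_alg ext_cls_add ext_scale_cls gam_cls pl.alt_rep_linear
        contract_linear)
qed

text \<open>The characterization of \<open>\<gamma>\<^sub>-(w\<^sub>i)\<close> by the pairing.\<close>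

definition gamma_spec :: "idx \<Rightarrow> (idx falg set \<Rightarrow> idx falg set) \<Rightarrow> bool" where
  "gamma_spec i G \<longleftrightarrow> G \<in> ext_End q (u_plus q) \<and>
     G \<one>\<^bsub>ext_alg q (u_plus q)\<^esub> = \<zero>\<^bsub>ext_alg q (u_plus q)\<^esub> \<and>
     (\<forall>k. \<forall>v\<in>ext_deg q (u_plus q) (Suc k). G v \<in> ext_deg q (u_plus q) k \<and>
        (\<forall>w\<in>ext_deg q (u_minus q) k. ext_pair q lam k w (G v) =
           ext_pair q lam (Suc k) (w \<otimes>\<^bsub>ext_alg q (u_minus q)\<^esub> ext_cls q (u_minus q) (wmon [i])) v))"

lemma alt_rep_tens: "t \<in> tens k \<Longrightarrow> pl.alt_rep t \<in> tens k"
  using pl.alt_rep_ext_tensors [of t k] by (simp add: ext_tensors_def)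

lemma alt_B0: "pl.alt B0 = 1"
proof (rule poly_mapping_eqI)
  fix w
  show "Poly_Mapping.lookup (pl.alt B0) w = Poly_Mapping.lookup 1 w"
    using cf_length [of w B0] by (cases w) (simp_all add: pl.lookup_alt lookup_one zero_list_def,
        simp add: cf_def)
qed

lemma gamma_spec_gam: "gamma_spec i (gam i)"
  unfolding gamma_spec_def
proof (intro conjI allI ballI)
  show "gam i \<in> ext_End q (u_plus q)" by (rule gam_End)
  have "contract lam i (pl.alt_rep 1) = 0"
  proof -
    have "gcoef i m B0 = 0" for m by (cases m) (simp_all add: gcoef_def)
    then show ?thesis
      using pl.alt_rep_alt [of B0] contract_alt [of i B0] by (simp add: alt_B0)
  qed
  then show "gam i \<one>\<^bsub>ext_alg q (u_plus q)\<^esub> = \<zero>\<^bsub>ext_alg q (u_plus q)\<^esub>"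
    by (simp add: ext_cls_one ext_cls_zero gam_cls)
next
  fix k v assume "v \<in> ext_deg q (u_plus q) (Suc k)"
  then obtain t where t: "t \<in> tens (Suc k)" "v = pl.cls t" by (auto simp: ext_deg_def)
  have c: "contract lam i (pl.alt_rep t) \<in> tens k" using t by (intro contract_tens alt_rep_tens)
  then show "gam i v \<in> ext_deg q (u_plus q) k" by (simp add: t gam_cls ext_deg_def)
  fix w assume "w \<in> ext_deg q (u_minus q) k"
  then obtain s where s: "s \<in> tens k" "w = mi.cls s" by (auto simp: ext_deg_def)
  have s': "s * wmon [i] \<in> tens (Suc k)" using tens_mult [OF s(1) tens_wmon [of "[i]"]] by simp
  show "ext_pair q lam k w (gam i v) =
      ext_pair q lam (Suc k) (w \<otimes>\<^bsub>ext_alg q (u_minus q)\<^esub> ext_cls q (u_minus q) (wmon [i])) v"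
    using tensor_pair_contract [OF s(1) lam]
    by (simp add: s t gam_cls ext_pair_cls c s' alt_rep_contract ext_cls_mult)
qed

lemma gamma_spec_unique:
  assumes G: "gamma_spec i G" and H: "gamma_spec i H"
  shows "G = H"
proof (rule ext_End_eqI)
  show "G \<in> ext_End q (u_plus q)" "H \<in> ext_End q (u_plus q)" using G H by (simp_all add: gamma_spec_def)
  fix w
  show "G (pl.cls (wmon w)) = H (pl.cls (wmon w))"
  proof (cases w)
    case Nil
    then show ?thesis using G H by (simp add: gamma_spec_def wmon_Nil ext_cls_one)
  next
    case (Cons j u)
    let ?v = "pl.cls (wmon w)" and ?k = "length u"
    have v: "?v \<in> ext_deg q (u_plus q) (Suc ?k)"
      using tens_wmon [of w] by (simp add: ext_deg_def Cons)
    have "G ?v \<in> ext_deg q (u_plus q) ?k" using G v by (simp add: gamma_spec_def)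
    then obtain x where x: "x \<in> tens ?k" "G ?v = pl.cls x" by (auto simp: ext_deg_def)
    have "H ?v \<in> ext_deg q (u_plus q) ?k" using H v by (simp add: gamma_spec_def)
    then obtain y where y: "y \<in> tens ?k" "H ?v = pl.cls y" by (auto simp: ext_deg_def)
    have "Poly_Mapping.lookup (pl.alt_rep x) a = Poly_Mapping.lookup (pl.alt_rep y) a" for a
    proof (cases "length a = ?k")
      case True
      then have s: "wmon (rev a) \<in> tens ?k" using tens_wmon [of "rev a"] by simp
      then have "mi.cls (wmon (rev a)) \<in> ext_deg q (u_minus q) ?k" by (simp add: ext_deg_def)
      then have "ext_pair q lam ?k (mi.cls (wmon (rev a))) (pl.cls x) =
          ext_pair q lam ?k (mi.cls (wmon (rev a))) (pl.cls y)"
        using G H v unfolding gamma_spec_def x(2) [symmetric] y(2) [symmetric] by metis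
      then have "tensor_pair (wmon (rev a)) (pl.alt_rep x) = tensor_pair (wmon (rev a)) (pl.alt_rep y)"
        using lam by (simp add: ext_pair_cls s x y)
      then show ?thesis by (simp add: tensor_pair_lfun_left lfun_wmon)
    qed (simp add: tens_lookup [OF alt_rep_tens [OF x(1)]] tens_lookup [OF alt_rep_tens [OF y(1)]])
    then have "pl.alt_rep x = pl.alt_rep y" by (rule poly_mapping_eqI)
    then show ?thesis by (simp add: x y pl.cls_eq_iff)
  qed
qed

lemma Gam_eq: "Gam q lam i = gam i"
  unfolding Gam_def gamma_minus_def gamma_spec_def [symmetric]
  by (rule the_equality) (auto intro: gamma_spec_gam gamma_spec_unique)

lemma gam_alt: "gam i (pl.cls (pl.alt n)) = pl.cls (\<Sum>m\<in>UNIV. smul (gcoef i m n) (pl.alt m))"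
  by (simp add: gam_cls pl.alt_rep_alt contract_alt)

end

section \<open>Invariant inner products and the contradiction\<close>

text \<open>The weight of a basis element, as a multiple of \<open>\<alpha>\<close>.\<close>

fun eb_wt :: "eb \<Rightarrow> int" where
  "eb_wt (B1 i) = idx_wt i" | "eb_wt (B2 i) = idx_wt i" | "eb_wt n = 0"

lemma coef_weight: "coef p k w \<noteq> 0 \<Longrightarrow> sum_list (map idx_wt w) = eb_wt (tgt w)"
proof (induction w)
  case (Cons i w)
  have "eb_wt (shift i n) = idx_wt i + eb_wt n" if "lc p k i n \<noteq> 0" for n
  proof (cases n)
    case (B1 j)
    with that show ?thesis by (cases i; cases j; simp)
  next
    case (B2 j)
    with that show ?thesis by (cases i; cases j; simp)
  qed (use that in auto)
  with Cons show ?case by simp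
qed simp

lemma uq_star_word: "uq_star (wmon u) = prod_list (map star_gen (rev u))"
  by (simp add: uq_star_def wmon_def)

lemma vec_u_plus_K1: "vec (u_plus q) K1 i = smul (of_real (q powi (2 * idx_wt i))) (wmon [i])"
  by (cases i) (simp_all add: vec_def u_plus_def smul_wmon UNIV_idx)

lemma K1_word:
  assumes "q > 0"
  shows "gen_on_word (u_plus q) K1 w = smul (of_real (q powi (2 * sum_list (map idx_wt w)))) (wmon w)"
proof (induction w)
  case (Cons i w)
  then show ?case
    using assms by (simp add: vec_u_plus_K1 smul_mult_left smul_mult_right wmon_mult power_int_add
        distrib_left)
qed (simp add: wmon_Nil)

lemma ext_End_cls_ex:
  assumes "G \<in> ext_End q M"
  shows "\<exists>y. G (ext_cls q M x) = ext_cls q M y"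
proof -
  have "G (ext_cls q M x) \<in> carrier (ext_alg q M)"
    using assms ext_cls_carrier [of q M x] unfolding ext_End_def by blast
  then show ?thesis by (auto simp: carrier_ext_alg)
qed

locale gamma_setting = dual_pair +
  fixes ip :: "idx falg set \<Rightarrow> idx falg set \<Rightarrow> complex"
  assumes ip: "invariant_inner_product q ip"
begin

lemma ip_rules:
  shows ip_add: "ip (pl.cls s) (pl.cls (x + y)) = ip (pl.cls s) (pl.cls x) + ip (pl.cls s) (pl.cls y)"
    and ip_smul: "ip (pl.cls s) (pl.cls (smul c x)) = c * ip (pl.cls s) (pl.cls x)"
    and ip_cnj: "ip (pl.cls x) (pl.cls y) = cnj (ip (pl.cls y) (pl.cls x))"
    and ip_pos: "pl.cls x \<noteq> pl.cls 0 \<Longrightarrow> Re (ip (pl.cls x) (pl.cls x)) > 0"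
    and ip_deg: "x \<in> tens k \<Longrightarrow> y \<in> tens l \<Longrightarrow> k \<noteq> l \<Longrightarrow> ip (pl.cls x) (pl.cls y) = 0"
    and ip_star: "ip (pl.cls s) (pl.cls (uq_act (u_plus q) Z x)) =
        ip (pl.cls (uq_act (u_plus q) (uq_star Z) s)) (pl.cls x)"
proof -
  note I = ip [unfolded invariant_inner_product_def Let_def]
  note I2 = I [THEN conjunct2] note I3 = I2 [THEN conjunct2] note I4 = I3 [THEN conjunct2]
  note I5 = I4 [THEN conjunct2] note I6 = I5 [THEN conjunct2]
  show "ip (pl.cls s) (pl.cls (x + y)) = ip (pl.cls s) (pl.cls x) + ip (pl.cls s) (pl.cls y)"
    using I [THEN conjunct1] by (simp add: ext_cls_add [symmetric])
  show "ip (pl.cls s) (pl.cls (smul c x)) = c * ip (pl.cls s) (pl.cls x)"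
    using I2 [THEN conjunct1] by (simp add: ext_scale_cls [symmetric])
  show "ip (pl.cls x) (pl.cls y) = cnj (ip (pl.cls y) (pl.cls x))"
    by (rule I3 [THEN conjunct1, rule_format]) simp_all
  show "pl.cls x \<noteq> pl.cls 0 \<Longrightarrow> Re (ip (pl.cls x) (pl.cls x)) > 0"
    using I4 [THEN conjunct1] by (simp add: ext_cls_zero)
  show "x \<in> tens k \<Longrightarrow> y \<in> tens l \<Longrightarrow> k \<noteq> l \<Longrightarrow> ip (pl.cls x) (pl.cls y) = 0"
    by (rule I5 [THEN conjunct1, rule_format]) (auto simp: ext_deg_def)
  show "ip (pl.cls s) (pl.cls (uq_act (u_plus q) Z x)) = ip (pl.cls (uq_act (u_plus q) (uq_star Z)
      s)) (pl.cls x)"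
    using I6 by blast
qed

lemma ip_add_left: "ip (pl.cls (x + y)) (pl.cls s) = ip (pl.cls x) (pl.cls s) + ip (pl.cls y) (pl.cls s)"
  unfolding ip_cnj [of _ s] by (simp add: ip_add)

lemma ip_smul_left: "ip (pl.cls (smul c x)) (pl.cls s) = cnj c * ip (pl.cls x) (pl.cls s)"
  unfolding ip_cnj [of _ s] by (simp add: ip_smul)

lemma ip_zero: "ip (pl.cls s) (pl.cls 0) = 0" "ip (pl.cls 0) (pl.cls s) = 0"
  using ip_smul [of s 0 0] ip_smul_left [of 0 0 s] by simp_all

lemma ip_sum: "ip (pl.cls s) (pl.cls (\<Sum>a\<in>A. x a)) = (\<Sum>a\<in>A. ip (pl.cls s) (pl.cls (x a)))"
  by (induction A rule: infinite_finite_induct) (simp_all add: ip_zero ip_add)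

lemma ip_sum_left: "ip (pl.cls (\<Sum>a\<in>A. x a)) (pl.cls s) = (\<Sum>a\<in>A. ip (pl.cls (x a)) (pl.cls s))"
  by (induction A rule: infinite_finite_induct) (simp_all add: ip_zero ip_add_left)

lemma cls_eqI:
  assumes "\<And>s. ip (pl.cls x) (pl.cls s) = ip (pl.cls y) (pl.cls s)"
  shows "pl.cls x = pl.cls y"
proof (rule ccontr)
  assume "pl.cls x \<noteq> pl.cls y"
  then have "pl.cls (x - y) \<noteq> pl.cls 0" by (simp add: ext_cls_eq_iff)
  then have "Re (ip (pl.cls (x - y)) (pl.cls (x - y))) > 0" by (rule ip_pos)
  moreover have "ip (pl.cls (x - y)) (pl.cls s) = 0" for s
    using assms [of s] ip_add_left [of "x - y" y s] by simp
  ultimately show False by simp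
qed

text \<open>The basis of the exterior algebra, and the squared norms of its elements.\<close>

abbreviation b :: "eb \<Rightarrow> idx falg set" where "b n \<equiv> pl.cls (pl.alt n)"

definition sqn :: "eb \<Rightarrow> complex" where "sqn n = ip (b n) (b n)"

lemma sqn_nonzero: "sqn n \<noteq> 0"
proof -
  have "pl.alt n \<noteq> 0"
    using pl.lookup_alt [of n "nword n"] by (auto simp: cf_nword)
  then have "b n \<noteq> pl.cls 0"
    using pl.alt_rep_linear(2) [of 0 0] by (simp add: pl.cls_eq_iff pl.alt_rep_alt)
  then have "Re (sqn n) > 0" unfolding sqn_def by (rule ip_pos)
  then show ?thesis by auto
qed

lemma cnj_sqn: "cnj (sqn n) = sqn n"
  unfolding sqn_def by (rule ip_cnj [symmetric])

lemma K1_alt: "uq_act (u_plus q) (wmon [K1]) (pl.alt n) = smul (of_real (q powi (2 * eb_wt n))) (pl.alt n)"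
proof (rule poly_mapping_eqI)
  fix w
  have "uq_act (u_plus q) (wmon [K1]) (pl.alt n) =
      (\<Sum>w | length w = deg n. smul (cf pl.p pl.kap n w) (smul (of_real (q powi (2 * sum_list (map
          idx_wt w)))) (wmon w)))"
    unfolding uq_act_mon pl.alt_def using q01
    by (simp add: linext_sum linext_smul linext_wmon K1_word del: gen_on_word.simps)
  also have "\<dots> = (\<Sum>w | length w = deg n. smul (of_real (q powi (2 * eb_wt n))) (smul (cf pl.p pl.kap
      n w) (wmon w)))"
    using coef_weight [of pl.p pl.kap] by (intro sum.cong) (auto simp: cf_def)
  also have "\<dots> = smul (of_real (q powi (2 * eb_wt n))) (pl.alt n)"
    by (simp add: pl.alt_def falg.scale_sum_right)
  finally show "Poly_Mapping.lookup (uq_act (u_plus q) (wmon [K1]) (pl.alt n)) w =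
      Poly_Mapping.lookup (smul (of_real (q powi (2 * eb_wt n))) (pl.alt n)) w" by simp
qed

text \<open>Elements of different degrees are orthogonal by assumption. Those of the same degree belong
  to different eigenvalues of \<open>K\<close>, which is self-adjoint.\<close>

lemma ip_orthogonal:
  assumes "m \<noteq> n"
  shows "ip (b m) (b n) = 0"
proof (cases "deg m = deg n")
  case False
  then show ?thesis using ip_deg pl.alt_tens by blast
next
  case True
  then have wt: "eb_wt m \<noteq> eb_wt n"
  proof -
    have "idx_wt i = idx_wt j \<Longrightarrow> i = j" for i j by (cases i; cases j; simp)
    then show ?thesis using True assms by (cases m; cases n) auto
  qed
  have "q powi (2 * eb_wt m) \<noteq> q powi (2 * eb_wt n)"
    using q01 wt power_int_strict_decreasing [of "2 * eb_wt m" "2 * eb_wt n" q]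
      power_int_strict_decreasing [of "2 * eb_wt n" "2 * eb_wt m" q] by (cases "eb_wt m < eb_wt n") auto
  moreover have "of_real (q powi (2 * eb_wt n)) * ip (b m) (b n) =
      of_real (q powi (2 * eb_wt m)) * ip (b m) (b n)"
    using ip_star [of "pl.alt m" "wmon [K1]" "pl.alt n"]
    by (simp add: K1_alt uq_star_word ip_smul ip_smul_left del: of_real_power_int)
  ultimately show ?thesis by (metis mult_right_cancel of_real_eq_iff)
qed

lemma ip_b: "ip (b m) (b n) = (if m = n then sqn n else 0)"
  by (simp add: sqn_def ip_orthogonal)

lemma cls_expand: "pl.cls t = pl.cls (\<Sum>n\<in>UNIV. smul (pl.lf n t / pl.alt_norm n) (pl.alt n))"
  using pl.cls_alt_rep [of t] by (simp add: pl.alt_rep_def)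

lemma parseval: "ip (pl.cls s) (pl.cls t) = (\<Sum>n\<in>UNIV. ip (pl.cls s) (b n) * ip (b n) (pl.cls t) / sqn n)"
proof -
  have "ip (b n) (pl.cls t) = pl.lf n t / pl.alt_norm n * sqn n" for n
  proof -
    have "ip (b n) (pl.cls t) = (\<Sum>m\<in>UNIV. if n = m then pl.lf m t / pl.alt_norm m * sqn m else 0)"
      unfolding cls_expand [of t] ip_sum ip_smul ip_b by (rule sum.cong) auto
    then show ?thesis by simp
  qed
  moreover have "ip (pl.cls s) (pl.cls t) = (\<Sum>n\<in>UNIV. pl.lf n t / pl.alt_norm n * ip (pl.cls s) (b n))"
    by (subst cls_expand [of t]) (simp add: ip_sum ip_smul)
  ultimately show ?thesis by (simp add: sqn_nonzero mult.commute)
qed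

text \<open>The adjoint operator, written down in the orthogonal basis.\<close>

definition adj :: "(idx falg set \<Rightarrow> idx falg set) \<Rightarrow> idx falg set \<Rightarrow> idx falg set" where
  "adj G = (\<lambda>x\<in>carrier (ext_alg q (u_plus q)).
     pl.cls (\<Sum>n\<in>UNIV. smul (cnj (ip x (G (b n))) / sqn n) (pl.alt n)))"

lemma adj_eq:
  assumes G: "G \<in> ext_End q (u_plus q)"
  shows "ext_adj q ip G \<in> ext_End q (u_plus q)"
    and "ip (pl.cls s) (G (pl.cls t)) = ip (ext_adj q ip G (pl.cls s)) (pl.cls t)"
proof -
  let ?A = "ext_alg q (u_plus q)"
  let ?spec = "\<lambda>H. H \<in> ext_End q (u_plus q) \<and> (\<forall>u\<in>carrier ?A. \<forall>v\<in>carrier ?A. ip u (G v) = ip (H u) v)"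
  obtain g where g: "G (pl.cls x) = pl.cls (g x)" for x using ext_End_cls_ex [OF G] by metis
  have G_add: "pl.cls (g (x + y)) = pl.cls (g x + g y)" for x y
    using ext_End_cls(1) [OF G, of x y] by (simp add: g ext_cls_add)
  have G_smul: "pl.cls (g (smul c x)) = pl.cls (smul c (g x))" for c x
    using ext_End_cls(2) [OF G, of c x] by (simp add: g ext_scale_cls)
  have G_sum: "ip (pl.cls s) (pl.cls (g (\<Sum>n\<in>A. smul (c n) (y n)))) =
      (\<Sum>n\<in>A. c n * ip (pl.cls s) (pl.cls (g (y n))))"
    for s c and y :: "eb \<Rightarrow> idx falg" and A
  proof (induction A rule: infinite_finite_induct)
    case empty
    show ?case using G_smul [of 0 0] by (simp add: ip_zero)
  next
    case (infinite A)
    then show ?case using G_smul [of 0 0] by (simp add: ip_zero)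
  qed (simp_all add: G_add G_smul ip_add ip_smul)
  have adj_cls: "adj G (pl.cls s) = pl.cls (\<Sum>n\<in>UNIV. smul (cnj (ip (pl.cls s) (pl.cls (g (pl.alt
      n)))) / sqn n) (pl.alt n))" for s
    by (simp add: adj_def g)
  have 1: "adj G \<in> ext_End q (u_plus q)"
  proof -
    have "adj G \<in> extensional (carrier ?A)" by (simp add: adj_def)
    then show ?thesis
      by (auto simp: ext_End_def carrier_ext_alg ext_cls_add ext_scale_cls adj_cls ip_add_left ip_smul_left
        add_divide_distrib falg.scale_left_distrib sum.distrib falg.scale_sum_right)
  qed
  have 2: "ip (pl.cls s) (G (pl.cls t)) = ip (adj G (pl.cls s)) (pl.cls t)" for s t
  proof -
    have "ip (adj G (pl.cls s)) (b m) = ip (pl.cls s) (pl.cls (g (pl.alt m)))" for m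
    proof -
      have "ip (adj G (pl.cls s)) (b m) =
          (\<Sum>n\<in>UNIV. if n = m then ip (pl.cls s) (pl.cls (g (pl.alt n))) / sqn n * sqn n else 0)"
        unfolding adj_cls ip_sum_left ip_smul_left ip_b by (rule sum.cong) (auto simp: cnj_sqn)
      then show ?thesis by (simp add: sqn_nonzero)
    qed
    note m = this
    let ?c = "\<lambda>n. pl.lf n t / pl.alt_norm n"
    have "ip (pl.cls s) (G (pl.cls t)) = (\<Sum>n\<in>UNIV. ?c n * ip (pl.cls s) (pl.cls (g (pl.alt n))))"
      by (subst cls_expand) (simp add: g G_sum)
    moreover have "ip (adj G (pl.cls s)) (pl.cls t) = (\<Sum>n\<in>UNIV. ?c n * ip (adj G (pl.cls s)) (b n))"
      unfolding adj_cls by (subst cls_expand [of t]) (simp add: ip_sum ip_smul)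
    ultimately show ?thesis by (simp add: m)
  qed
  have "ext_adj q ip G = adj G"
    unfolding ext_adj_def
  proof (rule the_equality)
    show "?spec (adj G)" using 1 2 by (auto simp: carrier_ext_alg)
    fix H assume H: "?spec H"
    show "H = adj G"
    proof (rule extensionalityI)
      show "H \<in> extensional (carrier ?A)" "adj G \<in> extensional (carrier ?A)"
        using H 1 by (auto simp: ext_End_def)
      fix x assume "x \<in> carrier ?A"
      then obtain s where s: "x = pl.cls s" by (auto simp: carrier_ext_alg)
      have "H x \<in> carrier ?A" using H by (auto simp: ext_End_def s Pi_iff)
      then obtain y where y: "H x = pl.cls y" by (auto simp: carrier_ext_alg)
      have "ip (pl.cls y) (pl.cls t) = ip (adj G (pl.cls s)) (pl.cls t)" for t
        using H 2 [of s t] by (auto simp: s y [symmetric])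
      then show "H x = adj G x" unfolding y unfolding s adj_cls by (rule cls_eqI)
    qed
  qed
  then show "ext_adj q ip G \<in> ext_End q (u_plus q)"
    "ip (pl.cls s) (G (pl.cls t)) = ip (ext_adj q ip G (pl.cls s)) (pl.cls t)"
    using 1 2 by auto
qed

abbreviation gadj :: "idx \<Rightarrow> idx falg set \<Rightarrow> idx falg set" where "gadj i \<equiv> ext_adj q ip (gam i)"

lemmas gadj = adj_eq [OF gam_End]

lemma gadj_cls: "\<exists>y. gadj i (pl.cls x) = pl.cls y"
  by (rule ext_End_cls_ex [OF gadj(1)])

lemma ip_gam_b: "ip (b m) (gam i (b n)) = gcoef i m n * sqn m"
proof -
  have "ip (b m) (gam i (b n)) = (\<Sum>l\<in>UNIV. if m = l then gcoef i l n * sqn l else 0)"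
    unfolding gam_alt ip_sum ip_smul ip_b by (rule sum.cong) auto
  then show ?thesis by simp
qed

lemma ip_gam_gam: "ip (gam i (b m)) (gam j (b n)) = (\<Sum>l\<in>UNIV. cnj (gcoef i l m) * gcoef j l n * sqn l)"
proof -
  have "ip (gam i (b m)) (b l) = cnj (ip (b l) (gam i (b m)))" for l
    unfolding gam_alt by (rule ip_cnj)
  then have "ip (gam i (b m)) (b l) = cnj (gcoef i l m) * sqn l" for l
    by (simp add: ip_gam_b cnj_sqn)
  then have "ip (gam i (b m)) (gam j (b n)) = (\<Sum>l\<in>UNIV. (cnj (gcoef i l m) * sqn l) * (gcoef j l n *
      sqn l) / sqn l)"
    unfolding gam_cls by (subst parseval) (simp add: gam_cls [symmetric] ip_gam_b)
  then show ?thesis by (simp add: sqn_nonzero mult_ac)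
qed

lemma ip_gadj_gadj: "ip (gadj i (b m)) (gadj j (b n)) =
    (\<Sum>l\<in>UNIV. gcoef i m l * sqn m * cnj (gcoef j n l * sqn n) / sqn l)"
proof -
  obtain x y where x: "gadj i (b m) = pl.cls x" and y: "gadj j (b n) = pl.cls y" using gadj_cls by metis
  have "ip (gadj i (b m)) (b l) = gcoef i m l * sqn m" for l
    using gadj(2) [of "pl.alt m" i "pl.alt l"] by (simp add: ip_gam_b)
  moreover have "ip (b l) (gadj j (b n)) = cnj (ip (gadj j (b n)) (b l))" for l
    unfolding y by (rule ip_cnj)
  then have "ip (b l) (gadj j (b n)) = cnj (gcoef j n l * sqn n)" for l
    using gadj(2) [of "pl.alt n" j "pl.alt l"] by (simp add: ip_gam_b)
  ultimately show ?thesis unfolding x y by (subst parseval) simp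
qed

text \<open>Comparing norms: \<open>F x = s y\<close> and \<open>F\<^sup>* y = E K\<^sup>-\<^sup>1 y = c s x\<close> with \<open>s = [2]\<^sup>1\<^sup>/\<^sup>2\<close>.\<close>

lemma F_relation:
  assumes F: "linext (gen_on_word (u_plus q) F1) x = smul (of_real (sqrt (q + inverse q))) y"
    and EK: "linext (gen_on_word (u_plus q) E1) (linext (gen_on_word (u_plus q) K1inv) y) =
      smul (of_real (c * sqrt (q + inverse q))) x"
  shows "ip (pl.cls y) (pl.cls y) = of_real c * ip (pl.cls x) (pl.cls x)"
proof -
  have "sqrt (q + inverse q) \<noteq> 0" using q01 by (simp add: add_nonneg_eq_0_iff)
  moreover have "of_real (sqrt (q + inverse q)) * ip (pl.cls y) (pl.cls y) =
      of_real (c * sqrt (q + inverse q)) * ip (pl.cls x) (pl.cls x)"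
    using ip_star [of y "wmon [F1]" x]
    by (simp add: uq_star_word uq_act_mon F EK ip_smul ip_smul_left del: of_real_mult)
  ultimately show ?thesis by simp
qed

lemma alt_B1: "pl.alt (B1 i) = wmon [i]"
proof (rule poly_mapping_eqI)
  fix w
  show "Poly_Mapping.lookup (pl.alt (B1 i)) w = Poly_Mapping.lookup (wmon [i]) w"
  proof (cases "length w = 1")
    case True
    then obtain j where "w = [j]" by (auto simp: length_Suc_conv)
    then show ?thesis by (simp add: pl.lookup_alt cf_def lookup_wmon)
  qed (auto simp: pl.lookup_alt cf_length lookup_wmon)
qed

lemma vec_u_plus: "vec (u_plus q) g i = (\<Sum>j\<in>UNIV. smul (u_plus_mat q g j i) (wmon [j]))"
  by (simp add: vec_def u_plus_def smul_wmon)

lemma mat_u_plus: "mat (u_plus q) g j i = u_plus_mat q g j i"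
  by (simp add: u_plus_def)

lemma sqn_relations:
  shows "sqn (B1 I0) = sqn (B1 I1)" and "sqn (B1 Im1) = pl.p * sqn (B1 I0)" and "sqn (B2 I0) = sqn (B2 I1)"
proof -
  note ev = alt_B1 linext_mon linext_vec vec_u_plus idx_sum linext_smul linext_add linext_zero
      mat_u_plus power_int_minus
  show "sqn (B1 I0) = sqn (B1 I1)"
    using F_relation [of "pl.alt (B1 I1)" "pl.alt (B1 I0)" 1] by (simp add: sqn_def ev)
  show "sqn (B1 Im1) = pl.p * sqn (B1 I0)"
    using F_relation [of "pl.alt (B1 I0)" "pl.alt (B1 Im1)" "q ^ 2"] by (simp add: sqn_def ev pl.p_def)
  have alt: "pl.alt (B2 i) \<in> tens 2" for i using pl.alt_tens [of "B2 i"] by simp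
  have c: "pl.coord (pl.alt (B2 i)) a c = cf pl.p pl.kap (B2 i) [a, c]" for i a c
    by (simp add: pl.coord_def pl.lookup_alt)
  have kap: "pl.kap = 1 - (of_real q)\<^sup>2" "pl.p = (of_real q)\<^sup>2" by (simp_all add: kap_plus pl.p_def)
  note sub = alt gen_act_tens falg.subspace_scale [OF subspace_tens]
  have "linext (gen_on_word (u_plus q) F1) (pl.alt (B2 I1)) =
      smul (of_real (sqrt (q + inverse q))) (pl.alt (B2 I0))"
  proof (rule pl.coord_inject; (intro sub)?; intro ext)
    fix i j
    show "pl.coord (linext (gen_on_word (u_plus q) F1) (pl.alt (B2 I1))) i j =
        pl.coord (smul (of_real (sqrt (q + inverse q))) (pl.alt (B2 I0))) i j"
      using q01 by (cases i; cases j) (simp_all add: pl.coord_gen_act sub pl.coord_smul c act2_def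
          idx_sum cf_def
        kap power_int_minus field_simps)
  qed
  moreover have "linext (gen_on_word (u_plus q) E1) (linext (gen_on_word (u_plus q) K1inv) (pl.alt
      (B2 I0))) =
      smul (of_real (1 * sqrt (q + inverse q))) (pl.alt (B2 I1))"
  proof (rule pl.coord_inject; (intro sub)?; intro ext)
    fix i j
    show "pl.coord (linext (gen_on_word (u_plus q) E1) (linext (gen_on_word (u_plus q) K1inv)
        (pl.alt (B2 I0)))) i j =
        pl.coord (smul (of_real (1 * sqrt (q + inverse q))) (pl.alt (B2 I1))) i j"
      using q01 by (cases i; cases j) (simp_all add: pl.coord_gen_act sub pl.coord_smul c act2_def
          idx_sum cf_def
        kap power_int_minus field_simps)
  qed
  ultimately show "sqn (B2 I0) = sqn (B2 I1)"
    unfolding sqn_def by (subst F_relation [where c = 1]) simp_all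
qed

lemma ip_finsum:
  assumes "finite A" and "\<And>k. k \<in> A \<Longrightarrow> f k \<in> carrier (ext_alg q (u_plus q))"
  shows "ip (pl.cls s) (\<Oplus>\<^bsub>ext_alg q (u_plus q)\<^esub>k\<in>A. f k) = (\<Sum>k\<in>A. ip (pl.cls s) (f k))"
  using assms
proof (induction A rule: finite_induct)
  interpret ring "ext_alg q (u_plus q)" by (rule ring_ext_alg)
  {
    case empty
    show ?case by (simp add: ext_cls_zero ip_zero)
  next
    case (insert a A)
    then have "f a \<in> carrier (ext_alg q (u_plus q))"
      "(\<Oplus>\<^bsub>ext_alg q (u_plus q)\<^esub>k\<in>A. f k) \<in> carrier (ext_alg q (u_plus q))"
      by (auto intro: finsum_closed)
    moreover from this obtain x y where "f a = pl.cls x" "(\<Oplus>\<^bsub>ext_alg q (u_plus q)\<^esub>k\<in>A. f k) = pl.cls y"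
      by (auto simp: carrier_ext_alg)
    ultimately show ?case
      using insert by (subst finsum_insert) (auto simp: ext_cls_add ip_add)
  }
qed

text \<open>The relation for \<open>(i, j) = (1, 0)\<close> alone is contradictory.\<close>

lemma no_relations:
  assumes rel: "\<And>x. x \<in> carrier (ext_alg q (u_plus q)) \<Longrightarrow> gam I1 (gadj I0 x) =
       (\<Oplus>\<^bsub>ext_alg q (u_plus q)\<^esub>k\<in>UNIV. \<Oplus>\<^bsub>ext_alg q (u_plus q)\<^esub>l\<in>UNIV.
          ext_scale q (u_plus q) (c k l) (gadj k (gam l x)))"
  shows False
proof -
  \<comment> \<open>Both sides are paired with a basis element, and every adjoint is moved to the other side.\<close>
  have main: "ip (gadj I1 (b m)) (gadj I0 (b n)) = (\<Sum>k\<in>UNIV. \<Sum>l\<in>UNIV. c k l * ip (gam k (b m)) (gam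
      l (b n)))" for m n
  proof -
    interpret R: ring "ext_alg q (u_plus q)" by (rule ring_ext_alg)
    obtain y where y: "gadj I0 (b n) = pl.cls y" using gadj_cls by metis
    have in_carrier: "ext_scale q (u_plus q) (c k l) (gadj k (gam l (b n)))
        \<in> carrier (ext_alg q (u_plus q))" for k l
    proof -
      obtain z where "gadj k (gam l (b n)) = pl.cls z" unfolding gam_alt using gadj_cls by blast
      then show ?thesis by (simp add: ext_scale_cls)
    qed
    have "ip (gadj I1 (b m)) (gadj I0 (b n)) = ip (b m) (gam I1 (gadj I0 (b n)))"
      unfolding y gadj(2) ..
    also have "\<dots> = (\<Sum>k\<in>UNIV. \<Sum>l\<in>UNIV. ip (b m) (ext_scale q (u_plus q) (c k l) (gadj k (gam l (b n)))))"
      by (subst rel) (simp_all add: ip_finsum in_carrier R.finsum_closed)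
    also have "\<dots> = (\<Sum>k\<in>UNIV. \<Sum>l\<in>UNIV. c k l * ip (gam k (b m)) (gam l (b n)))"
    proof (intro sum.cong refl)
      fix k l
      obtain x where x: "gam l (b n) = pl.cls x" by (rule that [OF gam_alt])
      obtain w where w: "gam k (b m) = pl.cls w" by (rule that [OF gam_alt])
      obtain z where z: "gadj k (pl.cls x) = pl.cls z" using gadj_cls by blast
      have "ip (b m) (pl.cls z) = cnj (ip (pl.cls z) (b m))" by (rule ip_cnj)
      also have "\<dots> = cnj (ip (pl.cls x) (gam k (b m)))" unfolding gadj(2) z ..
      also have "\<dots> = ip (gam k (b m)) (pl.cls x)" unfolding w by (rule ip_cnj [symmetric])
      finally have "ip (b m) (pl.cls z) = ip (gam k (b m)) (pl.cls x)" .
      then show "ip (b m) (ext_scale q (u_plus q) (c k l) (gadj k (gam l (b n)))) =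
          c k l * ip (gam k (b m)) (gam l (b n))"
        by (simp add: x z ext_scale_cls ip_smul)
    qed
    finally show ?thesis .
  qed
  define p where "p = pl.p"
  have p: "p \<noteq> 0" "p \<noteq> 1" "cnj p = p" "pl.kap = 1 - p"
    using q01 pl.p_nonzero by (auto simp: p_def pl.p_def kap_plus power2_eq_1_iff simp flip: of_real_power)
  define \<mu> where "\<mu> k = lam (Suc k) / lam k" for k
  have \<mu>: "\<mu> k \<noteq> 0" for k using lam by (simp add: \<mu>_def)
  have g: "gcoef i m n = (if shift i m = n then \<mu> (deg m) * lc p (1 - p) i m else 0)" for i m n
    by (simp add: gcoef_def \<mu>_def p_def kap_plus)
  note ev = ip_gadj_gadj ip_gam_gam g UNIV_eb idx_sum p(3) cnj_sqn sqn_relations p_def [symmetric]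
  define N0 N1 N2 where "N0 = sqn B0" and "N1 = sqn (B1 I1)" and "N2 = sqn (B2 I1)"
  have N: "N0 \<noteq> 0" "N1 \<noteq> 0" "N2 \<noteq> 0" by (simp_all add: N0_def N1_def N2_def sqn_nonzero)
  define A where "A = \<mu> 1 * cnj (\<mu> 1) * N1 * N1 / N2"
  define C where "C = \<mu> 0 * cnj (\<mu> 0) * N0"
  have AC: "A \<noteq> 0" "C \<noteq> 0" using \<mu> N by (simp_all add: A_def C_def)
  \<comment> \<open>In degree 1 the matrix entries of the relation determine two of the coefficients.\<close>
  have 1: "- p * A = c I0 I1 * C"
    using main [of "B1 I0" "B1 I1"] by (simp add: ev A_def C_def N0_def N1_def N2_def mult_ac)
  have 2: "p * (1 - p) * A = c Im1 I0 * C"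
    using main [of "B1 Im1" "B1 I0"] by (simp add: ev A_def C_def N0_def N1_def N2_def mult_ac)
  \<comment> \<open>In degree 2 the adjoint of the contraction with \<open>w\<^sub>0\<close> kills \<open>b (B2 I1)\<close>, because degree 3 has weight 0 only.\<close>
  have 3: "0 = (\<mu> 1 * cnj (\<mu> 1) * N1) * (c I0 I1 * (1 - p) + c Im1 I0 * p)"
    using main [of "B2 I0" "B2 I1"] by (simp add: ev N1_def algebra_simps)
  have "0 = (c I0 I1 * C) * (1 - p) + (c Im1 I0 * C) * p"
    using 3 \<mu> N by (simp add: algebra_simps flip: distrib_left)
  then have "p * (1 - p) * (1 - p) * A = 0"
    unfolding 1 [symmetric] 2 [symmetric] by (simp add: algebra_simps)
  then show False using p AC by simp
qed

end

theorem proposition20: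
  fixes q :: real and lam :: "nat \<Rightarrow> complex"
    and ip :: "idx falg set \<Rightarrow> idx falg set \<Rightarrow> complex"
  assumes "0 < q" and "q < 1"
    and "\<And>k. lam k \<noteq> 0"
    and "invariant_inner_product q ip"
  shows "\<not> (\<exists>c :: idx \<Rightarrow> idx \<Rightarrow> idx \<Rightarrow> idx \<Rightarrow> complex. \<forall>i j. i \<noteq> j \<longrightarrow>
    (\<forall>x\<in>carrier (ext_alg q (u_plus q)).
       Gam q lam i (ext_adj q ip (Gam q lam j) x) =
       (\<Oplus>\<^bsub>ext_alg q (u_plus q)\<^esub>k\<in>UNIV. \<Oplus>\<^bsub>ext_alg q (u_plus q)\<^esub>l\<in>UNIV.
          ext_scale q (u_plus q) (c i j k l) (ext_adj q ip (Gam q lam k) (Gam q lam l x)))))"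
proof -
  interpret gamma_setting q lam ip
    by unfold_locales (use assms in auto)
  show ?thesis
    unfolding Gam_eq
  proof
    assume "\<exists>c :: idx \<Rightarrow> idx \<Rightarrow> idx \<Rightarrow> idx \<Rightarrow> complex. \<forall>i j. i \<noteq> j \<longrightarrow>
      (\<forall>x\<in>carrier (ext_alg q (u_plus q)). gam i (gadj j x) =
         (\<Oplus>\<^bsub>ext_alg q (u_plus q)\<^esub>k\<in>UNIV. \<Oplus>\<^bsub>ext_alg q (u_plus q)\<^esub>l\<in>UNIV.
            ext_scale q (u_plus q) (c i j k l) (gadj k (gam l x))))"
    then obtain c :: "idx \<Rightarrow> idx \<Rightarrow> idx \<Rightarrow> idx \<Rightarrow> complex" where c: "\<And>i j x. i \<noteq> j \<Longrightarrow>
      x \<in> carrier (ext_alg q (u_plus q)) \<Longrightarrow> gam i (gadj j x) =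
         (\<Oplus>\<^bsub>ext_alg q (u_plus q)\<^esub>k\<in>UNIV. \<Oplus>\<^bsub>ext_alg q (u_plus q)\<^esub>l\<in>UNIV.
            ext_scale q (u_plus q) (c i j k l) (gadj k (gam l x)))"
      by blast
    show False by (rule no_relations [of "c I1 I0"]) (rule c, simp_all)
  qed
qed

end
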